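(* Let $N,n\in\mathbb{N}$, let $\Omega\subset\mathbb{R}^n$ be open, let $p\in[1,\infty)$ with $p\ge N\wedge n$, let $U=W^{1,p}(\Omega,\mathbb{R}^N)$, let $V$ be a Banach space, $K:U\to V$ a (possibly nonlinear) map, $v^\dagger\in V$, and $q\ge 1$. Let $F:\Omega\times\mathbb{R}^N\times\mathbb{R}^\tau\to\mathbb{R}_{\ge 0}\cup\{+\infty\}$ be a Carathéodory function such that, for almost every $x\in\Omega$, the map $(u,\xi)\mapsto F(x,u,\xi)$ is convex and differentiable throughout its effective domain, with derivative denoted $F'_{u,\xi}=(F'_u,F'_\xi)$. Put $f(x,u,A)=F(x,u,T(A))$ for $(x,u,A)\in\Omega\times\mathbb{R}^N\times\mathbb{R}^{N\times n}$ and $$\mathcal{R}(u)=\int_\Omega F(x,u(x),T(\nabla u(x)))\,dx=\int_\Omega f(x,u(x),\nabla u(x))\,dx,\qquad u\in U.$$ Let $u^\dagger\in U$ be an $\mathcal{R}$-minimizing solution (of $K(u)=v^\dagger$) with $u^\dagger\in\mathrm{int\,dom}\,\mathcal{R}$, and suppose that the function $x\mapsto F'_{u,\xi}(x,u^\dagger(x),T(\nabla u^\dagger(x)))$ lies in $L^{p^*}(\Omega,\mathbb{R}^N)\times S^*$, where $p^*$ is the Hölder conjugate of $p$. Let $w\in W_{\mathrm{poly}}$ be the $W_{\mathrm{poly}}$-subgradient of $\mathcal{R}$ at $u^\dagger$ given by this function, i.e. $$w(u)=\int_\Omega F'_u(x,u^\dagger,T(\nabla u^\dagger))\cdot u\,dx+\int_\Omega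 F'_\xi(x,u^\dagger,T(\nabla u^\dagger))\cdot T(\nabla u)\,dx,\qquad u\in U.$$ Assume that there are constants $\beta_1\in[0,1)$, $\beta_2,\bar\alpha>0$ and $\rho>\bar\alpha\mathcal{R}(u^\dagger)$ such that $$w(u^\dagger)-w(u)\le\beta_1D^{\mathrm{poly}}_w(u;u^\dagger)+\beta_2\|K(u)-v^\dagger\|$$ holds for all $u\in U$ with $\|K(u)-v^\dagger\|^q+\bar\alpha\mathcal{R}(u)\le\rho$. Moreover, assume that there are $a\in L^{p^*}(\Omega)$ and $b,c\ge 0$ such that, for almost every $x\in\Omega$, $$|f'_{u,A}(x,u,A)|\le a(x)+b|u|^{p-1}+c|A|^{p-1}$$ for all $(u,A)$ in the effective domain of $f(x,\cdot,\cdot)$, and that $K$ is Gâteaux differentiable at $u^\dagger$. Then $\mathcal{R}$ is Gâteaux differentiable at $u^\dagger$ and $$\mathcal{R}'(u^\dagger)=w'(u^\dagger)\in\mathrm{ran}\,K'(u^\dagger)^\#.$$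
   Context: Notation. $N\wedge n=\min(N,n)$; $\sigma(s)=\binom{n}{s}\binom{N}{s}$; $\tau=\sum_{s=1}^{N\wedge n}\sigma(s)$; $\tau_2=\sum_{s=2}^{N\wedge n}\sigma(s)$. Matrices in $\mathbb{R}^{N\times n}$ are identified with vectors in $\mathbb{R}^{Nn}$. For $A\in\mathbb{R}^{N\times n}$, $\mathrm{adj}_sA\in\mathbb{R}^{\sigma(s)}$ is the collection of all $s\times s$ minors of $A$, $T(A)=(A,\mathrm{adj}_2A,\ldots,\mathrm{adj}_{N\wedge n}A)\in\mathbb{R}^\tau$ and $T_2(A)=(\mathrm{adj}_2A,\ldots,\mathrm{adj}_{N\wedge n}A)\in\mathbb{R}^{\tau_2}$. Further $S=\prod_{s=1}^{N\wedge n}L^{p/s}(\Omega,\mathbb{R}^{\sigma(s)})$ and $S_2=\prod_{s=2}^{N\wedge n}L^{p/s}(\Omega,\mathbb{R}^{\sigma(s)})$; their duals $S^*,S_2^*$ are identified with the products of the spaces $L^{(p/s)^*}(\Omega,\mathbb{R}^{\sigma(s)})$. For $u\in U$ one has $T(\nabla u)\in S$ and $T_2(\nabla u)\in S_2$ by Hölder's inequality. A Carathéodory function is measurable in $x$ for all values of the remaining variables and continuous in the remaining variables for almost every $x$ (values in $[0,+\infty]$ with its usual topology). The effective domain of an extended-real-valued function is the set where it is $<+\infty$; $\mathrm{dom}\,\mathcal{R}=\{u\in U:\mathcal{R}(u)<+\infty\}$ and $\mathrm{int}$ denotes the interior in $U$. $W_{\mathrm{poly}}$ is the set of all $w:U\to\mathbb{R}$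 for which there is $(u^*,v^* )\in U^*\times S_2^*$ with $w(u)=\langle u^*,u\rangle_{U^*,U}+\langle v^*,T_2(\nabla u)\rangle_{S_2^*,S_2}$ for all $u\in U$. A $W_{\mathrm{poly}}$-subgradient of $\mathcal{R}$ at $u\in\mathrm{dom}\,\mathcal{R}$ is a $w\in W_{\mathrm{poly}}$ with $\mathcal{R}(v)\ge\mathcal{R}(u)+w(v)-w(u)$ for all $v\in U$. The $W_{\mathrm{poly}}$-Bregman distance is $D^{\mathrm{poly}}_w(v;u)=\mathcal{R}(v)-\mathcal{R}(u)-w(v)+w(u)$. It is a known fact that, under the stated assumptions on $F$ and $u^\dagger$, the function $w$ defined in the claim is a $W_{\mathrm{poly}}$-subgradient of $\mathcal{R}$ at $u^\dagger$. An $\mathcal{R}$-minimizing solution is an element $u^\dagger\in\arg\min\{\mathcal{R}(u):u\in U,\ K(u)=v^\dagger\}$; in particular $K(u^\dagger)=v^\dagger$. Gâteaux derivative: for a map $G$ between normed spaces, $G'(u;h)=\lim_{t\to0^+}\frac1t(G(u+th)-G(u))$ if the limit exists; $G$ is Gâteaux differentiable at $u$ if $G'(u;h)$ exists for all $h$ and there is a bounded linear operator $G'(u)$ with $G'(u)h=G'(u;h)$ for all $h$. For a bounded linear operator $A:U\to V$, the dual-adjoint $A^\#:V^*\to U^*$ is defined by $\langle A^\#v^*,u\rangle_{U^*,U}=\langle v^*,Au\rangle_{V^*,V}$ for all $u\in U$, $v^*\in V^*$; $\mathrm{ran}$ denotes the range. *)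

theory Defs
  imports "HOL-Analysis.Analysis"
begin

section \<open>Minors\<close>

text \<open>An index is a pair of a set of rows and a set of columns, both of the same size
  \<open>s \<ge> 1\<close>. Hence \<open>real ^ ('N, 'n) minor_index\<close> is the space of dimension
  \<open>\<tau> = (\<Sum>s = 1..min N n. (n choose s) * (N choose s))\<close>.\<close>

typedef ('a, 'b) minor_index = "{(I :: 'a set, J :: 'b set). card I = card J \<and> 0 < card I}"
  by (rule exI[of _ "({undefined}, {undefined})"]) simp

setup_lifting type_definition_minor_index

lift_definition minor_rows :: "('a, 'b) minor_index \<Rightarrow> 'a set" is fst .
lift_definition minor_cols :: "('a, 'b) minor_index \<Rightarrow> 'b set" is snd .

definition minor_size :: "('a, 'b) minor_index \<Rightarrow> nat" where
  "minor_size k = card (minor_rows k)"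

instance minor_index :: (finite, finite) finite
proof
  have "inj_on Rep_minor_index (UNIV :: ('a, 'b) minor_index set)"
    by (simp add: inj_on_def Rep_minor_index_inject)
  then show "finite (UNIV :: ('a, 'b) minor_index set)"
    by (rule finite_imageD[rotated]) (rule finite_subset[OF subset_UNIV finite])
qed

text \<open>Leibniz formula; rows and columns of the submatrix are kept in increasing order.\<close>

definition minor ::
  "real ^ 'n::{finite,linorder} ^ 'N::{finite,linorder} \<Rightarrow> ('N, 'n) minor_index \<Rightarrow> real" where
  "minor A k =
    (let s = minor_size k;
         r = sorted_list_of_set (minor_rows k);
         c = sorted_list_of_set (minor_cols k)
     in \<Sum>\<pi> | \<pi> permutes {..<s}. of_int (sign \<pi>) * (\<Prod>i<s. A $ (r ! i) $ (c ! \<pi> i)))"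

text \<open>The map \<open>T\<close>: the components with \<open>minor_size k = s\<close> form \<open>adj\<^sub>s A\<close>; those of size 1
  are the entries of \<open>A\<close>.\<close>

definition all_minors ::
  "real ^ 'n::{finite,linorder} ^ 'N::{finite,linorder} \<Rightarrow> real ^ ('N, 'n) minor_index" where
  "all_minors A = (\<chi> k. minor A k)"


section \<open>Lebesgue and Sobolev spaces\<close>

text \<open>Elements of the function spaces are represented by functions on the whole space, of which
  only the values on \<open>\<Omega>\<close> matter, up to null sets.\<close>

definition Lspace ::
  "'a::euclidean_space set \<Rightarrow> ereal \<Rightarrow> ('a \<Rightarrow> 'b::euclidean_space) set" where
  "Lspace \<Omega> r = {f. f \<in> borel_measurable (lebesgue_on \<Omega>) \<and>
     (if r = \<infinity> then \<exists>C. AE x in lebesgue_on \<Omega>. norm (f x) \<le> C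
      else integrable (lebesgue_on \<Omega>) (\<lambda>x. norm (f x) powr real_of_ereal r))}"

definition holder_conj :: "real \<Rightarrow> ereal" where
  "holder_conj r = (if r = 1 then \<infinity> else ereal (r / (r - 1)))"

text \<open>The product of the spaces \<open>L\<close> with exponent \<open>(p/s)\<^sup>*\<close> and values in the \<open>s\<close>-th block,
  written componentwise.\<close>

definition S_dual ::
  "(real ^ 'n::finite) set \<Rightarrow> real \<Rightarrow> (real ^ 'n \<Rightarrow> real ^ ('N::finite, 'n) minor_index) set" where
  "S_dual \<Omega> p = {v. \<forall>k. (\<lambda>x. v x $ k) \<in> Lspace \<Omega> (holder_conj (p / real (minor_size k)))}"

definition partial_deriv :: "'n::finite \<Rightarrow> (real ^ 'n \<Rightarrow> real) \<Rightarrow> real ^ 'n \<Rightarrow> real" where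
  "partial_deriv j \<phi> x = frechet_derivative \<phi> (at x) (axis j 1)"

primrec C_k :: "nat \<Rightarrow> (real ^ 'n::finite \<Rightarrow> real) \<Rightarrow> bool" where
  "C_k 0 \<phi> \<longleftrightarrow> continuous_on UNIV \<phi>"
| "C_k (Suc k) \<phi> \<longleftrightarrow> (\<forall>x. \<phi> differentiable (at x)) \<and> (\<forall>j. C_k k (partial_deriv j \<phi>))"

definition test_functions :: "(real ^ 'n::finite) set \<Rightarrow> (real ^ 'n \<Rightarrow> real) set" where
  "test_functions \<Omega> = {\<phi>. (\<forall>k. C_k k \<phi>) \<and>
     compact (closure {x. \<phi> x \<noteq> 0}) \<and> closure {x. \<phi> x \<noteq> 0} \<subseteq> \<Omega>}"

definition locally_integrable ::
  "(real ^ 'n::finite) set \<Rightarrow> (real ^ 'n \<Rightarrow> 'b::euclidean_space) \<Rightarrow> bool" where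
  "locally_integrable \<Omega> f \<longleftrightarrow> (\<forall>C. compact C \<and> C \<subseteq> \<Omega> \<longrightarrow> integrable (lebesgue_on C) f)"

definition has_weak_gradient ::
  "(real ^ 'n::finite) set \<Rightarrow> (real ^ 'n \<Rightarrow> real ^ 'N::finite) \<Rightarrow>
   (real ^ 'n \<Rightarrow> real ^ 'n ^ 'N) \<Rightarrow> bool" where
  "has_weak_gradient \<Omega> u G \<longleftrightarrow> locally_integrable \<Omega> u \<and> locally_integrable \<Omega> G \<and>
     (\<forall>\<phi>\<in>test_functions \<Omega>. \<forall>i j.
        (LINT x|lebesgue_on \<Omega>. u x $ i * partial_deriv j \<phi> x) =
        - (LINT x|lebesgue_on \<Omega>. G x $ i $ j * \<phi> x))"

text \<open>A representative of the weak gradient, which is unique up to null sets.\<close>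

definition weak_grad ::
  "(real ^ 'n::finite) set \<Rightarrow> (real ^ 'n \<Rightarrow> real ^ 'N::finite) \<Rightarrow> real ^ 'n \<Rightarrow> real ^ 'n ^ 'N" where
  "weak_grad \<Omega> u = (SOME G. has_weak_gradient \<Omega> u G)"

definition W1p :: "(real ^ 'n::finite) set \<Rightarrow> real \<Rightarrow> (real ^ 'n \<Rightarrow> real ^ 'N::finite) set" where
  "W1p \<Omega> p = {u. u \<in> Lspace \<Omega> (ereal p) \<and>
     (\<exists>G. has_weak_gradient \<Omega> u G \<and> G \<in> Lspace \<Omega> (ereal p))}"

definition W1p_norm ::
  "(real ^ 'n::finite) set \<Rightarrow> real \<Rightarrow> (real ^ 'n \<Rightarrow> real ^ 'N::finite) \<Rightarrow> real" where
  "W1p_norm \<Omega> p u =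
     (LINT x|lebesgue_on \<Omega>. norm (u x) powr p + norm (weak_grad \<Omega> u x) powr p) powr (1 / p)"

definition W1p_interior ::
  "(real ^ 'n::finite) set \<Rightarrow> real \<Rightarrow> (real ^ 'n \<Rightarrow> real ^ 'N::finite) set \<Rightarrow>
   (real ^ 'n \<Rightarrow> real ^ 'N) set" where
  "W1p_interior \<Omega> p D = {u\<in>W1p \<Omega> p. \<exists>\<epsilon>>0. \<forall>v\<in>W1p \<Omega> p.
     W1p_norm \<Omega> p (\<lambda>x. v x - u x) < \<epsilon> \<longrightarrow> v \<in> D}"

text \<open>A function on representatives is a map on the Sobolev space iff it does not distinguish
  representatives of the same element.\<close>

definition respects_ae ::
  "(real ^ 'n::finite) set \<Rightarrow> real \<Rightarrow> ((real ^ 'n \<Rightarrow> real ^ 'N::finite) \<Rightarrow> 'v) \<Rightarrow> bool" where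
  "respects_ae \<Omega> p G \<longleftrightarrow> (\<forall>u\<in>W1p \<Omega> p. \<forall>v\<in>W1p \<Omega> p.
     (AE x in lebesgue_on \<Omega>. u x = v x) \<longrightarrow> G u = G v)"

definition W1p_bounded_linear ::
  "(real ^ 'n::finite) set \<Rightarrow> real \<Rightarrow>
   ((real ^ 'n \<Rightarrow> real ^ 'N::finite) \<Rightarrow> 'v::real_normed_vector) \<Rightarrow> bool" where
  "W1p_bounded_linear \<Omega> p L \<longleftrightarrow>
     (\<forall>u\<in>W1p \<Omega> p. \<forall>v\<in>W1p \<Omega> p. L (\<lambda>x. u x + v x) = L u + L v) \<and>
     (\<forall>c. \<forall>u\<in>W1p \<Omega> p. L (\<lambda>x. c *\<^sub>R u x) = c *\<^sub>R L u) \<and>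
     (\<exists>C. \<forall>u\<in>W1p \<Omega> p. norm (L u) \<le> C * W1p_norm \<Omega> p u)"


section \<open>Gateaux derivatives on the Sobolev space\<close>

definition diff_quotient ::
  "(('a \<Rightarrow> 'b::real_vector) \<Rightarrow> 'v::real_vector) \<Rightarrow> ('a \<Rightarrow> 'b) \<Rightarrow> ('a \<Rightarrow> 'b) \<Rightarrow> real \<Rightarrow> 'v" where
  "diff_quotient G u h t = (1 / t) *\<^sub>R (G (\<lambda>x. u x + t *\<^sub>R h x) - G u)"

definition gateaux_differentiable ::
  "(real ^ 'n::finite) set \<Rightarrow> real \<Rightarrow>
   ((real ^ 'n \<Rightarrow> real ^ 'N::finite) \<Rightarrow> 'v::real_normed_vector) \<Rightarrow> (real ^ 'n \<Rightarrow> real ^ 'N) \<Rightarrow> bool" where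
  "gateaux_differentiable \<Omega> p G u \<longleftrightarrow> (\<exists>L. W1p_bounded_linear \<Omega> p L \<and>
     (\<forall>h\<in>W1p \<Omega> p. (diff_quotient G u h \<longlongrightarrow> L h) (at_right 0)))"

text \<open>Operators on the Sobolev space are made extensional, so that equality of the functions
  below is equality of the operators.\<close>

definition gateaux_deriv ::
  "(real ^ 'n::finite) set \<Rightarrow> real \<Rightarrow>
   ((real ^ 'n \<Rightarrow> real ^ 'N::finite) \<Rightarrow> 'v::real_normed_vector) \<Rightarrow> (real ^ 'n \<Rightarrow> real ^ 'N) \<Rightarrow>
   (real ^ 'n \<Rightarrow> real ^ 'N) \<Rightarrow> 'v" where
  "gateaux_deriv \<Omega> p G u = (\<lambda>h\<in>W1p \<Omega> p. Lim (at_right 0) (diff_quotient G u h))"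

definition dual_adjoint ::
  "(real ^ 'n::finite) set \<Rightarrow> real \<Rightarrow>
   ((real ^ 'n \<Rightarrow> real ^ 'N::finite) \<Rightarrow> 'v::real_normed_vector) \<Rightarrow> ('v \<Rightarrow>\<^sub>L real) \<Rightarrow>
   (real ^ 'n \<Rightarrow> real ^ 'N) \<Rightarrow> real" where
  "dual_adjoint \<Omega> p A v' = (\<lambda>u\<in>W1p \<Omega> p. blinfun_apply v' (A u))"


section \<open>Polyconvex functionals\<close>

definition caratheodory ::
  "'x::euclidean_space set \<Rightarrow> ('x \<Rightarrow> 'a::topological_space \<Rightarrow> 'b::topological_space \<Rightarrow> ennreal) \<Rightarrow> bool" where
  "caratheodory \<Omega> F \<longleftrightarrow>
     (\<forall>u \<xi>. (\<lambda>x. F x u \<xi>) \<in> borel_measurable (lebesgue_on \<Omega>)) \<and>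
     (AE x in lebesgue_on \<Omega>. continuous_on UNIV (\<lambda>(u, \<xi>). F x u \<xi>))"

definition convex_ennreal :: "('a::real_vector \<Rightarrow> ennreal) \<Rightarrow> bool" where
  "convex_ennreal g \<longleftrightarrow> (\<forall>y z. \<forall>t\<in>{0..1}.
     g ((1 - t) *\<^sub>R y + t *\<^sub>R z) \<le> ennreal (1 - t) * g y + ennreal t * g z)"

text \<open>Used below only where \<open>g\<close> is differentiable.\<close>

definition gradient :: "('a::real_inner \<Rightarrow> real) \<Rightarrow> 'a \<Rightarrow> 'a" where
  "gradient g y = (THE D. GDERIV g y :> D)"

text \<open>Differentiability and derivatives of an extended-valued function \<open>g\<close> are those of
  \<open>enn2real \<circ> g\<close>, considered only at points where \<open>g\<close> is finite. When \<open>g\<close> is continuous into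
  \<open>[0,\<infinity>]\<close>, its effective domain is open, so the value 0 which \<open>enn2real\<close> assigns to \<open>\<infinity>\<close> is
  irrelevant.\<close>

definition differentiable_on_domain :: "('a::real_normed_vector \<Rightarrow> ennreal) \<Rightarrow> bool" where
  "differentiable_on_domain g \<longleftrightarrow> (\<forall>y. g y < \<infinity> \<longrightarrow> (\<lambda>z. enn2real (g z)) differentiable (at y))"

definition grad_joint ::
  "('x \<Rightarrow> 'a::real_inner \<Rightarrow> 'b::real_inner \<Rightarrow> ennreal) \<Rightarrow> 'x \<Rightarrow> 'a \<Rightarrow> 'b \<Rightarrow> 'a \<times> 'b" where
  "grad_joint F x u \<xi> = gradient (\<lambda>(y, \<eta>). enn2real (F x y \<eta>)) (u, \<xi>)"

text \<open>Needed because \<open>real ^ 'n\<close> fixes the sort of \<open>'n\<close> to be exactly \<open>finite\<close>.\<close>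

type_synonym 'n rvec = "(real, 'n) vec"
type_synonym ('N, 'n) rmat = "((real, 'n) vec, 'N) vec"

definition polyconvex_integrand ::
  "('x \<Rightarrow> 'u \<Rightarrow> ('N::{finite,linorder}, 'n::{finite,linorder}) minor_index rvec \<Rightarrow> ennreal) \<Rightarrow>
   'x \<Rightarrow> 'u \<Rightarrow> ('N, 'n) rmat \<Rightarrow> ennreal" where
  "polyconvex_integrand F x u A = F x u (all_minors A)"

definition polyconvex_functional ::
  "'n::{finite,linorder} rvec set \<Rightarrow>
   ('n rvec \<Rightarrow> 'N::{finite,linorder} rvec \<Rightarrow> ('N, 'n) minor_index rvec \<Rightarrow> ennreal) \<Rightarrow>
   ('n rvec \<Rightarrow> 'N rvec) \<Rightarrow> ennreal" where
  "polyconvex_functional \<Omega> F u = (\<integral>\<^sup>+x. F x (u x) (all_minors (weak_grad \<Omega> u x)) \<partial>lebesgue_on \<Omega>)"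

definition bregman_distance ::
  "('u \<Rightarrow> ennreal) \<Rightarrow> ('u \<Rightarrow> real) \<Rightarrow> 'u \<Rightarrow> 'u \<Rightarrow> ereal" where
  "bregman_distance R w v u = enn2ereal (R v) - enn2ereal (R u) - ereal (w v) + ereal (w u)"

text \<open>Nonnegative powers with the convention that the zeroth power is 1 also at 0, as opposed to
  \<open>0 powr 0 = 0\<close>.\<close>

definition rpow :: "real \<Rightarrow> real \<Rightarrow> real" where
  "rpow z r = (if r = 0 then 1 else z powr r)"

end

(* The growth condition keeps a finite value of f(x, ., .) from escaping to infinity along a segment,
   and it dominates the difference quotients of R, so that R'(u_dag) h is the integral of
   F'_u . h + F'_xi . T'(grad u_dag) grad h. The difference quotients of w have the same limit, being
   dominated since a minor of order s lies in L^(p/s). Dividing the source inequality at u_dag + t h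
   by t, the Bregman distance disappears in the limit t -> 0+ because R' = w'; what remains is
   |w'(h)| <= beta2 |K'(u_dag) h|. By the Hahn-Banach theorem the functional K'(u_dag) h |-> w'(h)
   extends to a bounded functional on V. The same bound gives the boundedness of w'. *)

theory Submission
  imports Defs
begin

text \<open>The Sobolev space is a set of representatives, and \<open>weak_grad\<close> is an
  arbitrary choice among weak gradients. That it is additive almost everywhere rests on the
  uniqueness of weak gradients, which is what the bump functions and the du Bois-Reymond lemma are
  for. The exceptional null set of \<open>u + t h\<close> depends on t, so limits at fixed x are
  taken with the combination of the two fixed gradients instead. The growth condition bounds the
  derivative of f in (u, A), not that of F in the minors; \<open>F\<xi>\<close> only identifies the
  limit. R and w therefore get different majorants, built from one function Z that dominates all
  norms along the segment. The strict inequality for \<rho>, together with continuity of K and R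
  along rays, makes the source inequality available at u_dag + t h for small t. The absolute value
  in the final estimate comes from using both h and -h. No inverse of K'(u_dag) on its range is at
  hand, so the extension theorem is stated for a subspace of V x R, the graph; the estimate itself
  makes this graph single-valued.\<close>

section \<open>The Hahn-Banach theorem\<close>

text \<open>Only one inequality is asked for in the homogeneity, and only for positive factors,
  since this is what passes directly to infima. Equality follows by applying it to the inverse
  factor.\<close>

definition sublinear :: "('v::real_vector \<Rightarrow> real) \<Rightarrow> bool" where
  "sublinear q \<longleftrightarrow> (\<forall>x y. q (x + y) \<le> q x + q y) \<and> (\<forall>c>0. \<forall>x. q (c *\<^sub>R x) \<le> c * q x)"

lemma sublinear_add: "sublinear q \<Longrightarrow> q (x + y) \<le> q x + q y"
  by (simp add: sublinear_def)

lemma sublinear_scale: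
  assumes "sublinear q" "0 < c"
  shows "q (c *\<^sub>R x) = c * q x"
proof (rule antisym)
  show "q (c *\<^sub>R x) \<le> c * q x"
    using assms by (simp add: sublinear_def)
  have "q (inverse c *\<^sub>R (c *\<^sub>R x)) \<le> inverse c * q (c *\<^sub>R x)"
    using assms unfolding sublinear_def by (meson positive_imp_inverse_positive)
  then show "c * q x \<le> q (c *\<^sub>R x)"
    using assms(2) by (simp add: field_simps)
qed

lemma sublinear_0: "sublinear q \<Longrightarrow> q 0 = 0"
  using sublinear_scale[of q 2 0] by simp

lemma sublinear_minus: "sublinear q \<Longrightarrow> - q (- x) \<le> q x"
  using sublinear_add[of q x "- x"] sublinear_0[of q] by simp

text \<open>For fixed y, the infimum over t \<ge> 0 of
  \<open>q (x + t *\<^sub>R y) - t * q y\<close> is sublinear in x and below q, hence equal to q by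
  minimality. Its value is at most the term for t = 1, which is the reverse of
  subadditivity.\<close>

lemma minimal_sublinear_linear:
  fixes q :: "'v::real_vector \<Rightarrow> real"
  assumes q: "sublinear q" and min: "\<And>r. sublinear r \<Longrightarrow> r \<le> q \<Longrightarrow> r = q"
  shows "linear q"
proof -
  have q_scale: "q (t *\<^sub>R y) = t * q y" if "0 \<le> t" for t y
    using that sublinear_scale[OF q, of t y] sublinear_0[OF q] by (cases "t = 0") auto
  have add: "q (x + y) = q x + q y" for x y
  proof -
    define r where "r x = (INF t\<in>{0..}. q (x + t *\<^sub>R y) - t * q y)" for x
    \<comment> \<open>A lower bound independent of t, from t y = (x + t y) + (- x); without it the
      real infimum would carry no information.\<close>
    have "- q (- x) \<le> q (x + t *\<^sub>R y) - t * q y" if "0 \<le> t" for x t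
      using sublinear_add[OF q, of "x + t *\<^sub>R y" "- x"] q_scale[OF that, of y] by simp
    then have bdd: "bdd_below ((\<lambda>t. q (x + t *\<^sub>R y) - t * q y) ` {0..})" for x
      by (intro bdd_belowI2[where m = "- q (- x)"]) auto
    have r_le: "r x \<le> q (x + t *\<^sub>R y) - t * q y" if "0 \<le> t" for x t
      unfolding r_def using that by (intro cINF_lower bdd) auto
    have "sublinear r"
      unfolding sublinear_def
    proof (intro conjI allI impI)
      fix x1 x2
      \<comment> \<open>The two infima are resolved one after the other; parameters t1 and t2 for
        the summands give t1 + t2 for the sum.\<close>
      have "r (x1 + x2) - r x1 \<le> q (x2 + t2 *\<^sub>R y) - t2 * q y" if t2: "0 \<le> t2" for t2
      proof -
        have "r (x1 + x2) - (q (x2 + t2 *\<^sub>R y) - t2 * q y) \<le> q (x1 + t1 *\<^sub>R y) - t1 * q y"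
          if t1: "0 \<le> t1" for t1
          using r_le[of "t1 + t2" "x1 + x2"] t1 t2
            sublinear_add[OF q, of "x1 + t1 *\<^sub>R y" "x2 + t2 *\<^sub>R y"]
          by (simp add: algebra_simps)
        then have "r (x1 + x2) - (q (x2 + t2 *\<^sub>R y) - t2 * q y) \<le> r x1"
          unfolding r_def[of x1] by (intro cINF_greatest) auto
        then show ?thesis by simp
      qed
      then have "r (x1 + x2) - r x1 \<le> r x2"
        unfolding r_def[of x2] by (intro cINF_greatest) auto
      then show "r (x1 + x2) \<le> r x1 + r x2" by simp
    next
      fix c :: real and x assume c: "0 < c"
      have "r (c *\<^sub>R x) / c \<le> q (x + t *\<^sub>R y) - t * q y" if "0 \<le> t" for t
        using r_le[of "c * t" "c *\<^sub>R x"] sublinear_scale[OF q c, of "x + t *\<^sub>R y"] c that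
        by (simp add: field_simps scaleR_add_right)
      then have "r (c *\<^sub>R x) / c \<le> r x"
        unfolding r_def[of x] by (intro cINF_greatest) auto
      then show "r (c *\<^sub>R x) \<le> c * r x"
        using c by (simp add: field_simps)
    qed
    moreover have "r \<le> q"
      using r_le[of 0] by (auto simp: le_fun_def)
    ultimately have "r = q" by (rule min)
    then show ?thesis
      using r_le[of 1 x] sublinear_add[OF q, of x y] by simp
  qed
  have neg: "q (- x) = - q x" for x
    using add[of x "- x"] sublinear_0[OF q] by simp
  show ?thesis
  proof (rule linearI)
    fix c x
    show "q (c *\<^sub>R x) = c *\<^sub>R q x"
      using q_scale[of c x] q_scale[of "- c" x] neg[of "c *\<^sub>R x"] by (cases "0 \<le> c") auto
  qed (rule add)
qed

text \<open>Zorn's lemma for the reversed order yields a minimal sublinear functional below p. A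
  nonempty chain is bounded below by its pointwise infimum, which is finite because every member q
  satisfies q x \<ge> - q (- x) \<ge> - p (- x).\<close>

lemma ex_linear_below_sublinear:
  fixes p :: "'v::real_vector \<Rightarrow> real"
  assumes p: "sublinear p"
  shows "\<exists>l. linear l \<and> l \<le> p"
proof -
  define A where "A = {q. sublinear q \<and> q \<le> p}"
  have "\<exists>m\<in>A. \<forall>q\<in>A. q \<le> m \<longrightarrow> q = m"
  proof (rule predicate_Zorn)
    show "partial_order_on A (relation_of (\<lambda>x y. y \<le> x) A)"
      by (rule partial_order_on_relation_ofI) auto
    fix C assume "C \<in> Chains (relation_of (\<lambda>x y. y \<le> x) A)"
    then have CA: "C \<subseteq> A" and chain: "\<And>x y. x \<in> C \<Longrightarrow> y \<in> C \<Longrightarrow> x \<le> y \<or> y \<le> x"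
      by (auto simp: Chains_def relation_of_def)
    show "\<exists>u\<in>A. \<forall>a\<in>C. u \<le> a"
    proof (cases "C = {}")
      case True
      then show ?thesis using p by (auto simp: A_def)
    next
      case False
      define u where "u x = (INF q\<in>C. q x)" for x
      have sub: "sublinear q" and le_p: "q x \<le> p x" if "q \<in> C" for q x
        using that CA by (auto simp: A_def le_fun_def)
      have "- p (- x) \<le> q x" if "q \<in> C" for q x
        using sublinear_minus[OF sub[OF that], of x] le_p[OF that, of "- x"] by simp
      then have bdd: "bdd_below ((\<lambda>q. q x) ` C)" for x
        by (intro bdd_belowI2[where m = "- p (- x)"]) auto
      have u_le: "u x \<le> q x" if "q \<in> C" for q x
        unfolding u_def using that by (intro cINF_lower bdd)
      have "sublinear u"
        unfolding sublinear_def
      proof (intro conjI allI impI)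
        fix x y
        have "u (x + y) - u x \<le> q2 y" if q2: "q2 \<in> C" for q2
        proof -
          have "u (x + y) - q2 y \<le> q1 x" if q1: "q1 \<in> C" for q1
          proof -
            \<comment> \<open>Subadditivity holds within a single functional only, so the smaller of
              the two is used for both summands.\<close>
            consider "q1 \<le> q2" | "q2 \<le> q1"
              using chain[OF q1 q2] by blast
            then show ?thesis
            proof cases
              case 1
              then show ?thesis
                using u_le[OF q1, of "x + y"] sublinear_add[OF sub[OF q1], of x y] le_funD[OF 1, of y]
                by linarith
            next
              case 2
              then show ?thesis
                using u_le[OF q2, of "x + y"] sublinear_add[OF sub[OF q2], of x y] le_funD[OF 2, of x]
                by linarith
            qed
          qed
          then have "u (x + y) - q2 y \<le> u x"
            unfolding u_def[of x] using False by (intro cINF_greatest) auto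
          then show ?thesis by simp
        qed
        then have "u (x + y) - u x \<le> u y"
          unfolding u_def[of y] using False by (intro cINF_greatest) auto
        then show "u (x + y) \<le> u x + u y" by simp
      next
        fix c :: real and x assume c: "0 < c"
        have "u (c *\<^sub>R x) / c \<le> q x" if "q \<in> C" for q
          using u_le[OF that, of "c *\<^sub>R x"] sublinear_scale[OF sub[OF that] c, of x] c
          by (simp add: field_simps)
        then have "u (c *\<^sub>R x) / c \<le> u x"
          unfolding u_def[of x] using False by (intro cINF_greatest) auto
        then show "u (c *\<^sub>R x) \<le> c * u x"
          using c by (simp add: field_simps)
      qed
      moreover obtain q where "q \<in> C" using False by blast
      then have "u \<le> p"
        using u_le le_p by (meson le_funI order_trans)
      ultimately show ?thesis
        using u_le by (auto simp: A_def le_fun_def)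
    qed
  qed
  then obtain m where m: "sublinear m" "m \<le> p"
    and min: "\<And>q. sublinear q \<Longrightarrow> q \<le> p \<Longrightarrow> q \<le> m \<Longrightarrow> q = m"
    by (auto simp: A_def)
  have "linear m"
    using m by (intro minimal_sublinear_linear min) (auto intro: order_trans)
  with m show ?thesis by blast
qed

text \<open>The subspace plays the role of the graph of the functional that is to be extended.\<close>

theorem hahn_banach_graph:
  fixes S :: "('v::real_normed_vector \<times> real) set"
  assumes S: "subspace S" and bound: "\<And>v r. (v, r) \<in> S \<Longrightarrow> \<bar>r\<bar> \<le> \<beta> * norm v" and "0 \<le> \<beta>"
  shows "\<exists>l :: 'v \<Rightarrow>\<^sub>L real. \<forall>(v, r)\<in>S. blinfun_apply l v = r"
proof -
  \<comment> \<open>The sublinear majorant that encodes both demands on a linear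
    \<open>l \<le> q\<close>: the pair (0, 0) gives l x \<le> \<beta> |x|, and x = v gives l v \<le>
    r for (v, r) in S. As S also contains (- v, - r), equality on S results.\<close>
  define q where "q x = (INF s\<in>S. \<beta> * norm (x - fst s) + snd s)" for x
  have S0: "(0, 0) \<in> S"
    using subspace_0[OF S] by (simp add: zero_prod_def)
  \<comment> \<open>Finiteness of the infimum: |r| \<le> \<beta> |v| \<le> \<beta> |x - v| + \<beta>
    |x|.\<close>
  have "- \<beta> * norm x \<le> \<beta> * norm (x - fst s) + snd s" if "s \<in> S" for x s
  proof -
    have "norm (fst s) \<le> norm (x - fst s) + norm x"
      by (metis norm_minus_commute norm_triangle_sub add.commute)
    then have "\<beta> * norm (fst s) \<le> \<beta> * norm (x - fst s) + \<beta> * norm x"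
      using \<open>0 \<le> \<beta>\<close> by (metis distrib_left mult_left_mono)
    then show ?thesis
      using bound[of "fst s" "snd s"] that by simp
  qed
  then have bdd: "bdd_below ((\<lambda>s. \<beta> * norm (x - fst s) + snd s) ` S)" for x
    by (intro bdd_belowI2[where m = "- \<beta> * norm x"]) auto
  have q_le: "q x \<le> \<beta> * norm (x - fst s) + snd s" if "s \<in> S" for x s
    unfolding q_def using that by (intro cINF_lower bdd)
  have ne: "S \<noteq> {}" using S0 by blast
  have "sublinear q"
    unfolding sublinear_def
  proof (intro conjI allI impI)
    fix x y
    have "q (x + y) - q x \<le> \<beta> * norm (y - fst s2) + snd s2" if s2: "s2 \<in> S" for s2
    proof -
      have "q (x + y) - (\<beta> * norm (y - fst s2) + snd s2) \<le> \<beta> * norm (x - fst s1) + snd s1"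
        if s1: "s1 \<in> S" for s1
      proof -
        have "norm (x + y - fst (s1 + s2)) \<le> norm (x - fst s1) + norm (y - fst s2)"
          using norm_triangle_ineq[of "x - fst s1" "y - fst s2"] by (simp add: algebra_simps)
        then have "\<beta> * norm (x + y - fst (s1 + s2)) \<le> \<beta> * norm (x - fst s1) + \<beta> * norm (y - fst s2)"
          using \<open>0 \<le> \<beta>\<close> by (metis distrib_left mult_left_mono)
        then show ?thesis
          using q_le[OF subspace_add[OF S s1 s2], of "x + y"] by simp
      qed
      then have "q (x + y) - (\<beta> * norm (y - fst s2) + snd s2) \<le> q x"
        unfolding q_def[of x] using ne by (intro cINF_greatest) auto
      then show ?thesis by simp
    qed
    then have "q (x + y) - q x \<le> q y"
      unfolding q_def[of y] using ne by (intro cINF_greatest) auto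
    then show "q (x + y) \<le> q x + q y" by simp
  next
    fix c :: real and x assume c: "0 < c"
    have "q (c *\<^sub>R x) / c \<le> \<beta> * norm (x - fst s) + snd s" if s: "s \<in> S" for s
    proof -
      have "norm (c *\<^sub>R x - fst (c *\<^sub>R s)) = c * norm (x - fst s)"
        using c by (metis abs_of_pos fst_scaleR norm_scaleR scaleR_diff_right)
      then show ?thesis
        using q_le[OF subspace_scale[OF S s, of c], of "c *\<^sub>R x"] c by (simp add: field_simps)
    qed
    then have "q (c *\<^sub>R x) / c \<le> q x"
      unfolding q_def[of x] using ne by (intro cINF_greatest) auto
    then show "q (c *\<^sub>R x) \<le> c * q x"
      using c by (simp add: field_simps)
  qed
  then obtain l where l: "linear l" and le: "\<And>x. l x \<le> q x"
    using ex_linear_below_sublinear by (metis le_funD)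
  have le_norm: "l x \<le> \<beta> * norm x" for x
    using le[of x] q_le[OF S0, of x] by simp
  have "bounded_linear l"
  proof (rule bounded_linear_intro)
    show "l (x + y) = l x + l y" for x y by (rule linear_add[OF l])
    show "l (r *\<^sub>R x) = r *\<^sub>R l x" for r x by (rule linear_scale[OF l])
    show "norm (l x) \<le> norm x * \<beta>" for x
      using le_norm[of x] le_norm[of "- x"] linear_neg[OF l, of x] by (simp add: mult.commute)
  qed
  moreover have "l (fst s) = snd s" if s: "s \<in> S" for s
  proof (rule antisym)
    show "l (fst s) \<le> snd s"
      using le[of "fst s"] q_le[OF s, of "fst s"] by simp
    show "snd s \<le> l (fst s)"
      using le[of "fst (- s)"] q_le[OF subspace_neg[OF S s], of "fst (- s)"] linear_neg[OF l, of "fst s"]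
      by simp
  qed
  ultimately show ?thesis
    by (intro exI[of _ "Blinfun l"]) (auto simp: bounded_linear_Blinfun_apply)
qed

section \<open>Smooth bump functions\<close>

lemma C_k_SucD: "C_k (Suc k) \<phi> \<Longrightarrow> C_k k \<phi>"
proof (induction k arbitrary: \<phi>)
  case 0
  then show ?case
    by (auto intro!: continuous_at_imp_continuous_on differentiable_imp_continuous_within)
qed auto

lemma C_k_continuous: "C_k k \<phi> \<Longrightarrow> continuous_on UNIV \<phi>"
  by (induction k) (auto dest: C_k_SucD simp del: C_k.simps(2))

lemma partial_deriv_const: "partial_deriv j (\<lambda>x. c) = (\<lambda>x. 0)"
  by (simp add: partial_deriv_def fun_eq_iff)

lemma C_k_const: "C_k k (\<lambda>x. c)"
  by (induction k arbitrary: c) (auto simp: partial_deriv_const)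

lemma partial_deriv_eq: "(\<phi> has_derivative D) (at x) \<Longrightarrow> partial_deriv j \<phi> x = D (axis j 1)"
  unfolding partial_deriv_def by (metis frechet_derivative_at)

lemma partial_deriv_add:
  assumes "\<And>x. \<phi> differentiable (at x)" "\<And>x. \<psi> differentiable (at x)"
  shows "partial_deriv j (\<lambda>x. \<phi> x + \<psi> x) = (\<lambda>x. partial_deriv j \<phi> x + partial_deriv j \<psi> x)"
proof
  fix x
  show "partial_deriv j (\<lambda>x. \<phi> x + \<psi> x) x = partial_deriv j \<phi> x + partial_deriv j \<psi> x"
    unfolding partial_deriv_def[of j \<phi>] partial_deriv_def[of j \<psi>] using assms[of x]
    by (subst partial_deriv_eq[OF has_derivative_add])
      (auto simp: frechet_derivative_works[symmetric])
qed

lemma partial_deriv_mult: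
  assumes "\<And>x. \<phi> differentiable (at x)" "\<And>x. \<psi> differentiable (at x)"
  shows "partial_deriv j (\<lambda>x. \<phi> x * \<psi> x) =
    (\<lambda>x. \<phi> x * partial_deriv j \<psi> x + partial_deriv j \<phi> x * \<psi> x)"
proof
  fix x
  show "partial_deriv j (\<lambda>x. \<phi> x * \<psi> x) x = \<phi> x * partial_deriv j \<psi> x + partial_deriv j \<phi> x * \<psi> x"
    unfolding partial_deriv_def[of j \<phi>] partial_deriv_def[of j \<psi>] using assms[of x]
    by (subst partial_deriv_eq[OF has_derivative_mult])
      (auto simp: frechet_derivative_works[symmetric])
qed

lemma C_k_add: "C_k k \<phi> \<Longrightarrow> C_k k \<psi> \<Longrightarrow> C_k k (\<lambda>x. \<phi> x + \<psi> x)"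
  by (induction k arbitrary: \<phi> \<psi>)
    (auto intro!: continuous_on_add differentiable_add simp: partial_deriv_add)

lemma C_k_mult: "C_k k \<phi> \<Longrightarrow> C_k k \<psi> \<Longrightarrow> C_k k (\<lambda>x. \<phi> x * \<psi> x)"
proof (induction k arbitrary: \<phi> \<psi>)
  case 0
  then show ?case by (auto intro!: continuous_on_mult)
next
  case (Suc k)
  have "C_k k (partial_deriv j (\<lambda>x. \<phi> x * \<psi> x))" for j
    using Suc.prems C_k_SucD[OF Suc.prems(1)] C_k_SucD[OF Suc.prems(2)]
    by (subst partial_deriv_mult) (auto intro!: C_k_add Suc.IH)
  then show ?case
    using Suc.prems by (auto intro!: differentiable_mult)
qed

lemma C_k_prod: "finite I \<Longrightarrow> (\<And>i. i \<in> I \<Longrightarrow> C_k k (\<phi> i)) \<Longrightarrow> C_k k (\<lambda>x. \<Prod>i\<in>I. \<phi> i x)"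
  by (induction I rule: finite_induct) (auto intro!: C_k_mult C_k_const)

text \<open>D lists a function together with its successive derivatives. Leaving m arbitrary lets
  the induction pass from \<open>D m\<close> to \<open>D (Suc m)\<close>; the inner derivative is
  only a constant factor.\<close>

lemma C_k_compose_affine:
  assumes D: "\<And>m t. (D m has_real_derivative D (Suc m) t) (at t)"
  shows "C_k k (\<lambda>x. D m (c * x $ i + d))"
proof (induction k arbitrary: m)
  case 0
  have "continuous_on UNIV (D m)"
    using D by (auto intro!: continuous_at_imp_continuous_on DERIV_isCont)
  then show ?case
    by (auto intro!: continuous_on_compose2[of UNIV "D m"] continuous_intros)
next
  case (Suc k)
  have *: "((\<lambda>x. D m (c * x $ i + d)) has_derivative (\<lambda>y. D (Suc m) (c * x $ i + d) * (c * y $ i))) (at x)"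
    for x :: "real ^ 'a"
    by (rule has_derivative_compose[where g = "D m" and f = "\<lambda>x. c * x $ i + d",
        OF _ D[of m "c * x $ i + d", unfolded has_field_derivative_def]])
      (auto intro!: derivative_eq_intros bounded_linear.has_derivative[OF bounded_linear_vec_nth])
  have "partial_deriv j (\<lambda>x. D m (c * x $ i + d)) =
      (\<lambda>x. D (Suc m) (c * x $ i + d) * (c * axis j 1 $ i))" for j
    by (rule ext) (rule partial_deriv_eq[OF *])
  then show ?case
    using * by (auto simp: differentiable_def intro!: C_k_mult C_k_const Suc)
qed

text \<open>The polynomial makes the family closed under differentiation: with s = 1/t, the
  derivative of P(s) exp(-s) in t is s^2 (P - P')(s) exp(-s). The case P = 1 is the classical smooth
  function that is flat at 0.\<close>

definition flat_exp :: "real poly \<Rightarrow> real \<Rightarrow> real" where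
  "flat_exp P t = (if 0 < t then poly P (1 / t) * exp (- (1 / t)) else 0)"

lemma poly_div_exp_tendsto_0: "((\<lambda>y::real. poly P y * exp (- y)) \<longlongrightarrow> 0) at_top"
proof -
  have "((\<lambda>y. \<Sum>i\<le>degree P. coeff P i * (y ^ i / exp y)) \<longlongrightarrow> (\<Sum>i\<le>degree P. coeff P i * 0)) at_top"
    by (intro tendsto_intros tendsto_power_div_exp_0)
  then show ?thesis
    by (simp add: poly_altdef sum_distrib_right exp_minus divide_inverse mult.assoc)
qed

lemma flat_exp_tendsto_0: "(flat_exp P \<longlongrightarrow> 0) (at_right 0)"
proof (rule Lim_transform_eventually)
  show "((\<lambda>t. poly P (inverse t) * exp (- inverse t)) \<longlongrightarrow> 0) (at_right 0)"
    by (rule filterlim_compose[OF poly_div_exp_tendsto_0 filterlim_inverse_at_top_right])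
  show "\<forall>\<^sub>F t in at_right 0. poly P (inverse t) * exp (- inverse t) = flat_exp P t"
    by (auto simp: eventually_at_filter flat_exp_def inverse_eq_divide)
qed

lemma flat_exp_has_derivative:
  "(flat_exp P has_real_derivative flat_exp ([:0, 0, 1:] * (P - pderiv P)) t) (at t)"
proof -
  consider "t < 0" | "t = 0" | "0 < t" by linarith
  then show ?thesis
  proof cases
    case 1
    have "((\<lambda>t. 0) has_real_derivative 0) (at t)" by simp
    then have "(flat_exp P has_real_derivative 0) (at t)"
      by (rule has_field_derivative_transform_within_open[of _ _ _ "{..<0}"]) (use 1 in \<open>auto simp: flat_exp_def\<close>)
    then show ?thesis using 1 by (simp add: flat_exp_def)
  next
    case 3
    have "((\<lambda>t. poly P (1 / t) * exp (- (1 / t))) has_real_derivative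
        (poly (pderiv P) (1 / t) * (- 1 / t\<^sup>2)) * exp (- (1 / t)) + (exp (- (1 / t)) * (1 / t\<^sup>2)) * poly P (1 / t)) (at t)"
      using 3 by (auto intro!: derivative_eq_intros DERIV_chain2[OF poly_DERIV] simp: power2_eq_square field_simps)
    then have "(flat_exp P has_real_derivative
        (poly (pderiv P) (1 / t) * (- 1 / t\<^sup>2)) * exp (- (1 / t)) + (exp (- (1 / t)) * (1 / t\<^sup>2)) * poly P (1 / t)) (at t)"
      by (rule has_field_derivative_transform_within_open[of _ _ _ "{0<..}"]) (use 3 in \<open>auto simp: flat_exp_def\<close>)
    then show ?thesis using 3 by (simp add: flat_exp_def algebra_simps power2_eq_square)
  next
    case 2
    have "((\<lambda>y. (flat_exp P y - flat_exp P 0) / (y - 0)) \<longlongrightarrow> 0) (at 0)"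
      unfolding filterlim_at_split
    proof
      show "((\<lambda>y. (flat_exp P y - flat_exp P 0) / (y - 0)) \<longlongrightarrow> 0) (at_left 0)"
        by (rule tendsto_eventually) (auto simp: eventually_at_filter flat_exp_def)
      \<comment> \<open>Division by y multiplies P by the variable, so the quotient is again in the
        family and tends to 0.\<close>
      show "((\<lambda>y. (flat_exp P y - flat_exp P 0) / (y - 0)) \<longlongrightarrow> 0) (at_right 0)"
        by (rule Lim_transform_eventually[OF flat_exp_tendsto_0[of "[:0, 1:] * P"]])
          (auto simp: eventually_at_filter flat_exp_def)
    qed
    then show ?thesis
      using 2 by (simp add: has_field_derivative_iff flat_exp_def)
  qed
qed

text \<open>The number m steepens the flanks: exp(-1/(m t)) tends to 1 for every t > 0 as m grows.
  The functions thus stay between 0 and 1, keep their support in the closed box, and converge to the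
  indicator of the open box.\<close>

definition bump :: "real ^ 'n::finite \<Rightarrow> real ^ 'n \<Rightarrow> real \<Rightarrow> real ^ 'n \<Rightarrow> real" where
  "bump a b m x =
    (\<Prod>i\<in>UNIV. flat_exp 1 (m * (x $ i - a $ i)) * flat_exp 1 (m * (b $ i - x $ i)))"

lemma flat_exp_1_bounds: "0 \<le> flat_exp 1 t" "flat_exp 1 t \<le> 1"
  by (auto simp: flat_exp_def)

lemma C_k_bump: "C_k k (bump a b m)"
proof -
  \<comment> \<open>The successive derivatives of \<open>flat_exp 1\<close>, obtained by iterating
    the map on polynomials.\<close>
  define D where "D k = flat_exp (((\<lambda>P. [:0, 0, 1:] * (P - pderiv P)) ^^ k) 1)" for k
  have D: "(D k has_real_derivative D (Suc k) t) (at t)" for k t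
    unfolding D_def funpow.simps o_apply by (rule flat_exp_has_derivative)
  have D0: "D 0 = flat_exp 1" by (simp add: D_def)
  have "C_k k (\<lambda>x. D 0 (m * x $ i + - m * a $ i))" "C_k k (\<lambda>x. D 0 (- m * x $ i + m * b $ i))" for i
    by (rule C_k_compose_affine, rule D)+
  then show ?thesis
    unfolding bump_def[abs_def] D0
    by (intro C_k_prod C_k_mult) (simp_all add: algebra_simps)
qed

lemma bump_eq_0: "x \<notin> box a b \<Longrightarrow> 0 < m \<Longrightarrow> bump a b m x = 0"
  unfolding bump_def mem_box_cart
  by (rule prod_zero) (auto simp: flat_exp_def zero_less_mult_iff)

lemma bump_bounds: "0 \<le> bump a b m x" "bump a b m x \<le> 1"
  unfolding bump_def by (auto intro!: prod_nonneg prod_le_1 mult_le_one mult_nonneg_nonneg flat_exp_1_bounds)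

lemma bump_tendsto_indicator: "(\<lambda>k. bump a b (real (Suc k)) x) \<longlonglongrightarrow> indicator (box a b) x"
proof (cases "x \<in> box a b")
  case True
  have *: "(\<lambda>k. flat_exp 1 (real (Suc k) * t)) \<longlonglongrightarrow> 1" if "0 < t" for t
  proof -
    have "(\<lambda>k. exp (- (1 / t * inverse (real (Suc k))))) \<longlonglongrightarrow> exp (- (1 / t * 0))"
      by (intro tendsto_intros LIMSEQ_inverse_real_of_nat)
    then show ?thesis
      using that by (simp add: flat_exp_def zero_less_mult_iff divide_inverse mult.commute)
  qed
  have "(\<lambda>k. bump a b (real (Suc k)) x) \<longlonglongrightarrow> (\<Prod>i\<in>(UNIV :: 'a set). 1 * 1)"
    unfolding bump_def using True by (intro tendsto_prod tendsto_mult *) (auto simp: mem_box_cart)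
  then show ?thesis using True by simp
next
  case False
  then show ?thesis by (simp add: bump_eq_0)
qed

lemma bump_test_function:
  assumes "cbox a b \<subseteq> \<Omega>" "0 < m"
  shows "bump a b m \<in> test_functions \<Omega>"
proof -
  have "closure {x. bump a b m x \<noteq> 0} \<subseteq> cbox a b"
    using bump_eq_0[of _ a b m] box_subset_cbox[of a b] assms(2) by (intro closure_minimal) auto
  moreover from this have "compact (closure {x. bump a b m x \<noteq> 0})"
    by (meson bounded_cbox bounded_subset closed_closure compact_eq_bounded_closed)
  ultimately show ?thesis
    using assms by (auto simp: test_functions_def C_k_bump)
qed

section \<open>Uniqueness of weak gradients\<close>

text \<open>Open boxes form a generator of the Borel sets that is stable under intersection, and the
  Borel sets over which the integral vanishes are closed under complements and countable disjoint
  unions. Hence all Borel sets have integral zero. To argue with Borel sets, f is first replaced by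
  a Borel function g equal to it almost everywhere.\<close>

lemma box_integrals_zero_imp_AE_zero:
  fixes f :: "'a::euclidean_space \<Rightarrow> real"
  assumes f: "integrable lebesgue f"
    and box: "\<And>c d. (LINT x|lebesgue. indicator (box c d) x * f x) = 0"
  shows "AE x in lebesgue. f x = 0"
proof -
  obtain g where g[measurable]: "g \<in> borel_measurable lborel" and fg: "AE x in lborel. f x = g x"
    using completion_ex_borel_measurable_real[of f lborel] f by (auto dest: borel_measurable_integrable)
  have [measurable]: "f \<in> borel_measurable lebesgue" "g \<in> borel_measurable lebesgue"
    using f g by (auto intro: measurable_completion)
  have fg': "AE x in lebesgue. f x = g x"
    using fg by (rule AE_completion)
  have "integrable lebesgue g"
    using f fg' by (subst integrable_cong_AE[of g _ f]) auto
  then have int: "integrable lborel g"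
    using g by (simp add: integrable_completion)
  have set_int: "set_integrable lborel A g" if "A \<in> sets borel" for A
    using integrable_mult_indicator[OF _ int, of A] that by (simp add: set_integrable_def)
  have box': "(LINT x:box c d|lborel. g x) = 0" for c d
  proof -
    have "(LINT x|lborel. indicator (box c d) x * g x) = (LINT x|lebesgue. indicator (box c d) x * g x)"
      by (subst integral_completion) auto
    also have "\<dots> = (LINT x|lebesgue. indicator (box c d) x * f x)"
      using fg' by (intro integral_cong_AE borel_measurable_times borel_measurable_indicator) auto
    finally show ?thesis by (simp add: set_lebesgue_integral_def box)
  qed
  \<comment> \<open>Needed for complements; the whole space is not a box but is exhausted by
    boxes.\<close>
  have total: "(LINT x|lborel. g x) = 0"
  proof -
    let ?B = "\<lambda>i::nat. box (- (real i *\<^sub>R One)) (real i *\<^sub>R One) :: 'a set"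
    have "(\<lambda>i. LINT x|lborel. indicator (?B i) x * g x) \<longlonglongrightarrow> (LINT x|lborel. g x)"
    proof (rule integral_dominated_convergence[where w = "\<lambda>x. \<bar>g x\<bar>"])
      show "AE x in lborel. (\<lambda>i. indicator (?B i) x * g x) \<longlonglongrightarrow> g x"
      proof (rule AE_I2)
        fix x
        obtain i where i: "x \<in> ?B i" using UN_box_eq_UNIV by blast
        have "?B i \<subseteq> ?B j" if "i \<le> j" for j
          using that by (intro subset_box_imp) (auto simp: inner_simps)
        then have "\<forall>\<^sub>F j in sequentially. indicator (?B j) x * g x = g x"
          using i by (intro eventually_sequentiallyI[of i]) (auto simp: indicator_def subset_eq)
        then show "(\<lambda>i. indicator (?B i) x * g x) \<longlonglongrightarrow> g x"
          by (rule tendsto_eventually)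
      qed
      show "AE x in lborel. norm (indicator (?B i) x * g x) \<le> \<bar>g x\<bar>" for i
        by (auto split: split_indicator)
    qed (use int in auto)
    moreover have "(LINT x|lborel. indicator (?B i) x * g x) = 0" for i
      using box'[of "- (real i *\<^sub>R One)" "real i *\<^sub>R One"] by (simp add: set_lebesgue_integral_def)
    ultimately show ?thesis by (simp add: LIMSEQ_const_iff)
  qed
  have zero: "(LINT x:A|lborel. g x) = 0" if "A \<in> sets borel" for A
  proof -
    let ?E = "range (\<lambda>(a, b). box a b :: 'a set)"
    have E: "sigma_sets UNIV ?E = sets borel" by (simp add: borel_eq_box)
    have "Int_stable ?E" by (auto simp: Int_stable_def box_Int_box)
    moreover have "?E \<subseteq> Pow UNIV" by simp
    moreover have "A \<in> sigma_sets UNIV ?E" using that E by simp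
    ultimately show ?thesis
    proof (induction rule: sigma_sets_induct_disjoint)
      case (basic A)
      then show ?case by (auto simp: box')
    next
      case (compl A)
      then have A: "A \<in> sets borel" using E by simp
      have "(LINT x:UNIV|lborel. g x) = (LINT x:A \<union> (UNIV - A)|lborel. g x)" by simp
      also have "\<dots> = (LINT x:A|lborel. g x) + (LINT x:UNIV - A|lborel. g x)"
        using A by (intro set_integral_Un set_int) auto
      finally show ?case using compl total by (simp add: set_lebesgue_integral_def)
    next
      case (union A)
      then have A: "\<And>i. A i \<in> sets borel" using E by auto
      then have "(LINT x:(\<Union>i. A i)|lborel. g x) = (\<Sum>i. (LINT x:A i|lborel. g x))"
        using union(1) by (intro lebesgue_integral_countable_add set_int) (auto simp: disjoint_family_on_def)
      then show ?case using union by simp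
    qed (simp add: set_lebesgue_integral_def)
  qed
  have "AE x in lborel. g x = 0"
    by (rule density_unique_real[OF int]) (simp_all add: zero)
  then show ?thesis
    using fg' AE_completion by (force elim!: eventually_elim2[rotated])
qed

lemma test_function_supportE:
  assumes "\<phi> \<in> test_functions \<Omega>"
  obtains C where "compact C" "C \<subseteq> \<Omega>" "continuous_on UNIV \<phi>" "\<And>x. x \<notin> C \<Longrightarrow> \<phi> x = 0"
    "\<And>j. continuous_on UNIV (partial_deriv j \<phi>)" "\<And>j x. x \<notin> C \<Longrightarrow> partial_deriv j \<phi> x = 0"
proof
  let ?C = "closure {x. \<phi> x \<noteq> 0}"
  have C_k: "C_k k \<phi>" for k using assms by (simp add: test_functions_def)
  show "compact ?C" "?C \<subseteq> \<Omega>" using assms by (auto simp: test_functions_def)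
  show "continuous_on UNIV \<phi>" using C_k[of 0] by simp
  show "continuous_on UNIV (partial_deriv j \<phi>)" for j using C_k[of 1] by simp
  show zero: "\<phi> x = 0" if "x \<notin> ?C" for x
    using that closure_subset[of "{x. \<phi> x \<noteq> 0}"] by auto
  show "partial_deriv j \<phi> x = 0" if "x \<notin> ?C" for j x
  proof -
    have "open (- ?C)" "x \<in> - ?C" "\<And>y. y \<in> - ?C \<Longrightarrow> 0 = \<phi> y"
      using that zero by (blast intro: open_Compl closed_closure, blast, metis ComplD)
    then have "(\<phi> has_derivative (\<lambda>_. 0)) (at x)"
      by (rule has_derivative_transform_within_open[OF has_derivative_const])
    from partial_deriv_eq[OF this] show ?thesis .
  qed
qed

text \<open>The function g need not be integrable on \<Omega>, but \<phi> is bounded on the compact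
  set C and vanishes outside it.\<close>

lemma integrable_locally_integrable_mult:
  fixes g :: "real ^ 'n::finite \<Rightarrow> real"
  assumes "locally_integrable \<Omega> g" "\<Omega> \<in> sets lebesgue" "compact C" "C \<subseteq> \<Omega>"
    and cont: "continuous_on UNIV \<phi>" and zero: "\<And>x. x \<notin> C \<Longrightarrow> \<phi> x = 0"
  shows "integrable (lebesgue_on \<Omega>) (\<lambda>x. g x * \<phi> x)"
proof -
  have C: "C \<in> sets lebesgue" using \<open>compact C\<close> by (simp add: lmeasurable_compact fmeasurableD)
  have "integrable (lebesgue_on C) g"
    using assms by (simp add: locally_integrable_def)
  then have g: "integrable lebesgue (\<lambda>x. indicator C x *\<^sub>R g x)"
    using C by (simp add: integrable_restrict_space)
  have "bounded (\<phi> ` C)"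
    using \<open>compact C\<close> cont by (meson compact_continuous_image compact_imp_bounded continuous_on_subset subset_UNIV)
  then obtain B where B: "\<And>x. x \<in> C \<Longrightarrow> \<bar>\<phi> x\<bar> \<le> B" by (auto simp: bounded_iff)
  have [measurable]: "\<phi> \<in> borel_measurable lebesgue"
    using cont by (simp add: borel_measurable_continuous_onI measurable_completion)
  have "integrable lebesgue (\<lambda>x. (indicator C x *\<^sub>R g x) * \<phi> x)"
  proof (rule Bochner_Integration.integrable_bound)
    show "integrable lebesgue (\<lambda>x. B * (indicator C x *\<^sub>R g x))" using g by simp
    show "(\<lambda>x. (indicator C x *\<^sub>R g x) * \<phi> x) \<in> borel_measurable lebesgue"
      using g by measurable
    show "AE x in lebesgue. norm (indicator C x *\<^sub>R g x * \<phi> x) \<le> norm (B * (indicator C x *\<^sub>R g x))"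
      using B by (force simp: abs_mult mult.commute indicator_def intro!: mult_right_mono)
  qed
  then have "integrable (lebesgue_on \<Omega>) (\<lambda>x. (indicator C x *\<^sub>R g x) * \<phi> x)"
    using \<open>\<Omega> \<in> sets lebesgue\<close> by (intro integrable_restrict_space[THEN iffD2] integrable_mult_indicator) auto
  also have "(\<lambda>x. (indicator C x *\<^sub>R g x) * \<phi> x) = (\<lambda>x. g x * \<phi> x)"
    using zero by (auto simp: fun_eq_iff indicator_def)
  finally show ?thesis .
qed

text \<open>Bump functions turn the hypothesis into vanishing integrals over open boxes whose closed
  box lies in \<Omega>: they converge to the indicator, dominated by |H| on the closed box. This
  forces H = 0 almost everywhere on each such box, and countably many of them cover \<Omega> up to a
  null set.\<close>

lemma du_Bois_Reymond:
  fixes H :: "real ^ 'n::finite \<Rightarrow> real"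
  assumes "open \<Omega>" and H: "locally_integrable \<Omega> H"
    and zero: "\<And>\<phi>. \<phi> \<in> test_functions \<Omega> \<Longrightarrow> (LINT x|lebesgue_on \<Omega>. H x * \<phi> x) = 0"
  shows "AE x in lebesgue_on \<Omega>. H x = 0"
proof -
  have \<Omega>: "\<Omega> \<in> sets lebesgue" using \<open>open \<Omega>\<close> by (simp add: borel_open)
  have int_cbox: "integrable lebesgue (\<lambda>x. indicator (cbox a b) x * H x)" if "cbox a b \<subseteq> \<Omega>" for a b
    using H that integrable_restrict_space[of "cbox a b" lebesgue H]
    by (simp add: locally_integrable_def)
  have zero_box: "(LINT x|lebesgue. indicator (box a b) x * H x) = 0" if sub: "cbox a b \<subseteq> \<Omega>" for a b
  proof -
    let ?\<phi> = "\<lambda>k. bump a b (real (Suc k))"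
    let ?H = "\<lambda>x. indicator (cbox a b) x * H x"
    have \<phi>m: "?\<phi> k \<in> borel_measurable lebesgue" for k
      by (intro measurable_completion) (simp add: borel_measurable_continuous_onI C_k_continuous[OF C_k_bump])
    have Hm[measurable]: "?H \<in> borel_measurable lebesgue" using int_cbox[OF sub] by simp
    have H_eq: "indicator (box a b) x * H x = indicator (box a b) x * ?H x" for x
      using box_subset_cbox[of a b] by (auto simp: indicator_def)
    have "(\<lambda>k. LINT x|lebesgue. ?H x * ?\<phi> k x) \<longlonglongrightarrow> (LINT x|lebesgue. indicator (box a b) x * ?H x)"
    proof (rule integral_dominated_convergence[where w = "\<lambda>x. norm (?H x)"])
      show "AE x in lebesgue. (\<lambda>k. ?H x * ?\<phi> k x) \<longlonglongrightarrow> indicator (box a b) x * ?H x"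
        by (intro AE_I2, subst mult.commute[of "indicator (box a b) _"])
          (rule tendsto_mult[OF tendsto_const bump_tendsto_indicator])
      show "AE x in lebesgue. norm (?H x * ?\<phi> k x) \<le> norm (?H x)" for k
        using bump_bounds[of a b "real (Suc k)"] by (auto simp: abs_mult intro!: mult_left_le)
      show "(\<lambda>x. indicator (box a b) x * ?H x) \<in> borel_measurable lebesgue"
        by (intro borel_measurable_times borel_measurable_indicator Hm) simp
      show "(\<lambda>x. ?H x * ?\<phi> k x) \<in> borel_measurable lebesgue" for k
        by (intro borel_measurable_times Hm \<phi>m)
    qed (use int_cbox[OF sub] in auto)
    moreover have "(LINT x|lebesgue. ?H x * ?\<phi> k x) = 0" for k
    proof -
      have "?H x * ?\<phi> k x = indicator \<Omega> x *\<^sub>R (H x * ?\<phi> k x)" for x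
        using bump_eq_0[of x a b "real (Suc k)"] box_subset_cbox[of a b] sub
        by (auto simp: indicator_def)
      then have "(LINT x|lebesgue. ?H x * ?\<phi> k x) = (LINT x|lebesgue. indicator \<Omega> x *\<^sub>R (H x * ?\<phi> k x))"
        by (simp only:)
      also have "\<dots> = (LINT x|lebesgue_on \<Omega>. H x * ?\<phi> k x)"
        using \<Omega> by (intro integral_restrict_space[symmetric]) simp
      also have "\<dots> = 0"
        by (intro zero bump_test_function[OF sub]) simp
      finally show ?thesis .
    qed
    ultimately show ?thesis by (simp only: H_eq LIMSEQ_const_iff)
  qed
  have AE_box: "AE x in lebesgue. x \<in> box a b \<longrightarrow> H x = 0" if sub: "cbox a b \<subseteq> \<Omega>" for a b
  proof -
    let ?f = "\<lambda>x. indicator (box a b) x * H x"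
    have "integrable lebesgue (\<lambda>x. indicator (box a b) x *\<^sub>R (indicator (cbox a b) x * H x))"
      using int_cbox[OF sub] by (intro integrable_mult_indicator) auto
    moreover have "indicator (box a b) x *\<^sub>R (indicator (cbox a b) x * H x) = ?f x" for x
      using box_subset_cbox[of a b] by (auto simp: indicator_def)
    ultimately have "integrable lebesgue ?f" by (simp only:)
    moreover have "(LINT x|lebesgue. indicator (box c d) x * ?f x) = 0" for c d
    proof -
      obtain c' d' where cd: "box c d \<inter> box a b = box c' d'" using box_Int_box by blast
      have eq: "indicator (box c d) x * ?f x = indicator (box c' d') x * H x" for x
        by (simp add: indicator_inter_arith flip: cd)
      show ?thesis
      \<comment> \<open>An empty intersection says nothing about where \<open>cbox c' d'\<close>
        lies. In the other case the closed box is the closure of the open one and hence a subset of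
        \<open>cbox a b\<close>.\<close>
      proof (cases "box c' d' = {}")
        case False
        then have "cbox c' d' \<subseteq> cbox a b"
          using cd closure_box[OF False] by (metis Int_lower2 box_subset_cbox closed_cbox closure_minimal subset_trans)
        then show ?thesis
          using zero_box[of c' d'] sub by (simp add: eq)
      qed (simp add: eq)
    qed
    ultimately have "AE x in lebesgue. ?f x = 0"
      by (rule box_integrals_zero_imp_AE_zero)
    then show ?thesis by eventually_elim (auto simp: indicator_def)
  qed
  obtain D where D: "countable D" "D \<subseteq> Pow \<Omega>" "\<And>X. X \<in> D \<Longrightarrow> \<exists>a b. X = cbox a b" "\<Union>D = \<Omega>"
    using open_countable_Union_open_cbox[OF \<open>open \<Omega>\<close>] by metis
  have "AE x in lebesgue. x \<in> X \<longrightarrow> H x = 0" if XD: "X \<in> D" for X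
  proof -
    obtain a b where X: "X = cbox a b" "cbox a b \<subseteq> \<Omega>"
      using D(2) D(3)[OF XD] XD by blast
    \<comment> \<open>The covering consists of closed boxes, the result above concerns open ones;
      the frontier is a null set.\<close>
    have "AE x in lebesgue. x \<notin> cbox a b - box a b"
      using negligible_frontier_interval[of a b] AE_not_in unfolding negligible_iff_null_sets by blast
    then show ?thesis
      using AE_box[OF X(2)] by eventually_elim (auto simp: X)
  qed
  then have "AE x in lebesgue. \<forall>X\<in>D. x \<in> X \<longrightarrow> H x = 0"
    by (subst AE_ball_countable[OF D(1)]) blast
  then have "AE x in lebesgue. x \<in> \<Omega> \<longrightarrow> H x = 0"
    by eventually_elim (use D(4) in blast)
  then show ?thesis using \<Omega> by (simp add: AE_restrict_space_iff)
qed

lemma locally_integrable_bounded_linear: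
  assumes "locally_integrable \<Omega> f" "bounded_linear T"
  shows "locally_integrable \<Omega> (\<lambda>x. T (f x))"
  using assms by (auto simp: locally_integrable_def intro: integrable_bounded_linear)

lemma locally_integrable_component:
  "locally_integrable \<Omega> u \<Longrightarrow> locally_integrable \<Omega> (\<lambda>x. u x $ i)"
  by (rule locally_integrable_bounded_linear[OF _ bounded_linear_vec_nth])

lemma locally_integrable_add_scaleR:
  assumes "locally_integrable \<Omega> f" "locally_integrable \<Omega> g"
  shows "locally_integrable \<Omega> (\<lambda>x. f x + t *\<^sub>R g x)"
  using assms by (auto simp: locally_integrable_def)

lemma integral_locally_integrable_add_mult:
  fixes f g :: "real ^ 'n::finite \<Rightarrow> real"
  assumes "locally_integrable \<Omega> f" "locally_integrable \<Omega> g" "\<Omega> \<in> sets lebesgue"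
    and "compact C" "C \<subseteq> \<Omega>" "continuous_on UNIV \<psi>" "\<And>x. x \<notin> C \<Longrightarrow> \<psi> x = 0"
  shows "(LINT x|lebesgue_on \<Omega>. (f x + t * g x) * \<psi> x) =
    (LINT x|lebesgue_on \<Omega>. f x * \<psi> x) + t * (LINT x|lebesgue_on \<Omega>. g x * \<psi> x)"
proof -
  have "integrable (lebesgue_on \<Omega>) (\<lambda>x. f x * \<psi> x)" "integrable (lebesgue_on \<Omega>) (\<lambda>x. g x * \<psi> x)"
    using assms by (auto intro: integrable_locally_integrable_mult)
  then show ?thesis by (simp add: distrib_right mult.assoc)
qed

text \<open>Every statement about the chosen representative \<open>weak_grad\<close> passes through
  this lemma: a gradient with the desired properties is exhibited, and the chosen one agrees with it
  almost everywhere.\<close>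

lemma weak_gradient_unique_AE:
  assumes "open \<Omega>" and G: "has_weak_gradient \<Omega> u G" and G': "has_weak_gradient \<Omega> u G'"
  shows "AE x in lebesgue_on \<Omega>. G x = G' x"
proof -
  have \<Omega>: "\<Omega> \<in> sets lebesgue" using \<open>open \<Omega>\<close> by (simp add: borel_open)
  have loc: "locally_integrable \<Omega> (\<lambda>x. G x $ i $ j)" "locally_integrable \<Omega> (\<lambda>x. G' x $ i $ j)" for i j
    using G G' by (auto simp: has_weak_gradient_def intro!: locally_integrable_component)
  have "AE x in lebesgue_on \<Omega>. G x $ i $ j + (- 1) *\<^sub>R G' x $ i $ j = 0" for i j
  proof (rule du_Bois_Reymond[OF \<open>open \<Omega>\<close>])
    show "locally_integrable \<Omega> (\<lambda>x. G x $ i $ j + (- 1) *\<^sub>R G' x $ i $ j)"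
      using loc by (rule locally_integrable_add_scaleR)
    fix \<phi> assume \<phi>: "\<phi> \<in> test_functions \<Omega>"
    obtain C where C: "compact C" "C \<subseteq> \<Omega>" "continuous_on UNIV \<phi>" "\<And>x. x \<notin> C \<Longrightarrow> \<phi> x = 0"
      using test_function_supportE[OF \<phi>] by metis
    have "(LINT x|lebesgue_on \<Omega>. (G x $ i $ j + (- 1) * G' x $ i $ j) * \<phi> x) =
        (LINT x|lebesgue_on \<Omega>. G x $ i $ j * \<phi> x) + (- 1) * (LINT x|lebesgue_on \<Omega>. G' x $ i $ j * \<phi> x)"
      by (rule integral_locally_integrable_add_mult) (use loc C \<Omega> in auto)
    moreover have "(LINT x|lebesgue_on \<Omega>. u x $ i * partial_deriv j \<phi> x) = - (LINT x|lebesgue_on \<Omega>. G x $ i $ j * \<phi> x)"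
      "(LINT x|lebesgue_on \<Omega>. u x $ i * partial_deriv j \<phi> x) = - (LINT x|lebesgue_on \<Omega>. G' x $ i $ j * \<phi> x)"
      using G G' \<phi> unfolding has_weak_gradient_def by blast+
    ultimately show "(LINT x|lebesgue_on \<Omega>. (G x $ i $ j + (- 1) *\<^sub>R G' x $ i $ j) * \<phi> x) = 0"
      by simp
  qed
  then have "AE x in lebesgue_on \<Omega>. \<forall>i\<in>UNIV. \<forall>j\<in>UNIV. G x $ i $ j + (- 1) *\<^sub>R G' x $ i $ j = 0"
    by (simp only: AE_finite_all finite) blast
  then show ?thesis by eventually_elim (simp add: vec_eq_iff)
qed

section \<open>Linear structure of the Sobolev space\<close>

lemma has_weak_gradient_add_scaleR:
  assumes "\<Omega> \<in> sets lebesgue" and G: "has_weak_gradient \<Omega> u G" and H: "has_weak_gradient \<Omega> v H"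
  shows "has_weak_gradient \<Omega> (\<lambda>x. u x + t *\<^sub>R v x) (\<lambda>x. G x + t *\<^sub>R H x)"
  unfolding has_weak_gradient_def
proof (intro conjI ballI allI)
  show "locally_integrable \<Omega> (\<lambda>x. u x + t *\<^sub>R v x)" "locally_integrable \<Omega> (\<lambda>x. G x + t *\<^sub>R H x)"
    using G H by (auto simp: has_weak_gradient_def intro: locally_integrable_add_scaleR)
  fix \<phi> i j assume \<phi>: "\<phi> \<in> test_functions \<Omega>"
  obtain C where C: "compact C" "C \<subseteq> \<Omega>" "continuous_on UNIV \<phi>" "\<And>x. x \<notin> C \<Longrightarrow> \<phi> x = 0"
    "continuous_on UNIV (partial_deriv j \<phi>)" "\<And>x. x \<notin> C \<Longrightarrow> partial_deriv j \<phi> x = 0"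
    using test_function_supportE[OF \<phi>] by metis
  note * = integral_locally_integrable_add_mult[OF _ _ assms(1) C(1,2)]
  show "(LINT x|lebesgue_on \<Omega>. (u x + t *\<^sub>R v x) $ i * partial_deriv j \<phi> x) =
      - (LINT x|lebesgue_on \<Omega>. (G x + t *\<^sub>R H x) $ i $ j * \<phi> x)"
    using G H \<phi> C unfolding has_weak_gradient_def
    by (simp add: * locally_integrable_component)
qed

text \<open>Completeness makes functions measurable that are only almost everywhere equal to, or
  almost everywhere limits of, measurable ones. This concerns the chosen weak gradients and the
  limits of difference quotients.\<close>

lemma complete_measure_lebesgue_on:
  assumes "\<Omega> \<in> sets lebesgue"
  shows "complete_measure (lebesgue_on \<Omega>)"
  using assms completion.complete by unfold_locales (auto simp: null_sets_restrict_space sets_restrict_space_iff)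

lemma (in complete_measure) measurable_cong_AE:
  assumes f: "f \<in> measurable M N" and g: "g \<in> space M \<rightarrow> space N" and eq: "AE x in M. f x = g x"
  shows "g \<in> measurable M N"
proof (rule measurableI)
  fix A assume "A \<in> sets N"
  show "g -` A \<inter> space M \<in> sets M"
    by (rule in_sets_AE[of "f -` A \<inter> space M"])
      (use eq measurable_sets[OF f \<open>A \<in> sets N\<close>] in auto)
qed (use g in auto)

lemma powr_add_le:
  fixes x y p :: real
  assumes "0 \<le> x" "0 \<le> y" "0 \<le> p"
  shows "(x + y) powr p \<le> 2 powr p * (x powr p + y powr p)"
proof -
  have "(x + y) powr p \<le> (2 * max x y) powr p"
    using assms by (intro powr_mono2) auto
  also have "\<dots> = 2 powr p * max x y powr p"
    using assms by (simp add: powr_mult)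
  also have "\<dots> \<le> 2 powr p * (x powr p + y powr p)"
    by (intro mult_left_mono) (auto simp: max_def)
  finally show ?thesis .
qed

lemma Lspace_ereal: "f \<in> Lspace \<Omega> (ereal p) \<longleftrightarrow>
    f \<in> borel_measurable (lebesgue_on \<Omega>) \<and> integrable (lebesgue_on \<Omega>) (\<lambda>x. norm (f x) powr p)"
  by (simp add: Lspace_def)

lemma Lspace_add:
  assumes "f \<in> Lspace \<Omega> (ereal p)" "g \<in> Lspace \<Omega> (ereal p)" "0 \<le> p"
  shows "(\<lambda>x. f x + g x) \<in> Lspace \<Omega> (ereal p)"
proof -
  have [measurable]: "f \<in> borel_measurable (lebesgue_on \<Omega>)" "g \<in> borel_measurable (lebesgue_on \<Omega>)"
    and int: "integrable (lebesgue_on \<Omega>) (\<lambda>x. norm (f x) powr p)" "integrable (lebesgue_on \<Omega>) (\<lambda>x. norm (g x) powr p)"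
    using assms by (auto simp: Lspace_ereal)
  have "integrable (lebesgue_on \<Omega>) (\<lambda>x. norm (f x + g x) powr p)"
  proof (rule Bochner_Integration.integrable_bound)
    show "integrable (lebesgue_on \<Omega>) (\<lambda>x. 2 powr p * (norm (f x) powr p + norm (g x) powr p))"
      using int by auto
    have "norm (f x + g x) powr p \<le> 2 powr p * (norm (f x) powr p + norm (g x) powr p)" for x
      using assms by (intro order_trans[OF powr_mono2 powr_add_le]) (auto intro: norm_triangle_ineq)
    then show "AE x in lebesgue_on \<Omega>. norm (norm (f x + g x) powr p)
        \<le> norm (2 powr p * (norm (f x) powr p + norm (g x) powr p))"
      by simp
  qed measurable
  then show ?thesis by (simp add: Lspace_ereal)
qed

lemma Lspace_scaleR: "f \<in> Lspace \<Omega> (ereal p) \<Longrightarrow> (\<lambda>x. t *\<^sub>R f x) \<in> Lspace \<Omega> (ereal p)"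
  by (auto simp: Lspace_ereal powr_mult)

lemma Lspace_norm: "f \<in> Lspace \<Omega> (ereal p) \<Longrightarrow> (\<lambda>x. norm (f x)) \<in> Lspace \<Omega> (ereal p)"
  by (auto simp: Lspace_ereal)

text \<open>Membership in \<open>W1p\<close> provides some p-integrable weak gradient, while
  \<open>weak_grad\<close> may be another one. Uniqueness transfers integrability to it, and
  completeness of the measure transfers measurability.\<close>

lemma W1pD:
  assumes "open \<Omega>" "u \<in> W1p \<Omega> p"
  shows "u \<in> Lspace \<Omega> (ereal p)" "has_weak_gradient \<Omega> u (weak_grad \<Omega> u)"
    "weak_grad \<Omega> u \<in> Lspace \<Omega> (ereal p)"
proof -
  show "u \<in> Lspace \<Omega> (ereal p)" using assms by (simp add: W1p_def)
  obtain G where G: "has_weak_gradient \<Omega> u G" "G \<in> Lspace \<Omega> (ereal p)"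
    using assms by (auto simp: W1p_def)
  show wg: "has_weak_gradient \<Omega> u (weak_grad \<Omega> u)"
    unfolding weak_grad_def by (rule someI[of "has_weak_gradient \<Omega> u", OF G(1)])
  have eq: "AE x in lebesgue_on \<Omega>. G x = weak_grad \<Omega> u x"
    using weak_gradient_unique_AE[OF \<open>open \<Omega>\<close> G(1) wg] .
  interpret complete_measure "lebesgue_on \<Omega>"
    using \<open>open \<Omega>\<close> by (intro complete_measure_lebesgue_on) (simp add: borel_open)
  have [measurable]: "weak_grad \<Omega> u \<in> borel_measurable (lebesgue_on \<Omega>)"
    using G(2) eq by (auto simp: Lspace_ereal intro: measurable_cong_AE)
  have "integrable (lebesgue_on \<Omega>) (\<lambda>x. norm (weak_grad \<Omega> u x) powr p)"
    using G(2) eq by (subst integrable_cong_AE[of _ _ "\<lambda>x. norm (G x) powr p"]) (auto simp: Lspace_ereal)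
  then show "weak_grad \<Omega> u \<in> Lspace \<Omega> (ereal p)"
    by (simp add: Lspace_ereal)
qed

lemma W1p_add_scaleR:
  assumes "open \<Omega>" "0 \<le> p" "u \<in> W1p \<Omega> p" "v \<in> W1p \<Omega> p"
  shows "(\<lambda>x. u x + t *\<^sub>R v x) \<in> W1p \<Omega> p"
    and "AE x in lebesgue_on \<Omega>. weak_grad \<Omega> (\<lambda>x. u x + t *\<^sub>R v x) x = weak_grad \<Omega> u x + t *\<^sub>R weak_grad \<Omega> v x"
proof -
  note u = W1pD[OF assms(1,3)] and v = W1pD[OF assms(1,4)]
  have wg: "has_weak_gradient \<Omega> (\<lambda>x. u x + t *\<^sub>R v x) (\<lambda>x. weak_grad \<Omega> u x + t *\<^sub>R weak_grad \<Omega> v x)"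
    using assms u v by (intro has_weak_gradient_add_scaleR) (auto simp: borel_open)
  then show 1: "(\<lambda>x. u x + t *\<^sub>R v x) \<in> W1p \<Omega> p"
    unfolding W1p_def using u v assms by (auto intro!: Lspace_add Lspace_scaleR)
  show "AE x in lebesgue_on \<Omega>. weak_grad \<Omega> (\<lambda>x. u x + t *\<^sub>R v x) x = weak_grad \<Omega> u x + t *\<^sub>R weak_grad \<Omega> v x"
    using weak_gradient_unique_AE[OF assms(1) W1pD(2)[OF assms(1) 1] wg] .
qed

lemma W1p_scaleR:
  assumes "open \<Omega>" "0 \<le> p" "u \<in> W1p \<Omega> p"
  shows "(\<lambda>x. c *\<^sub>R u x) \<in> W1p \<Omega> p"
    and "AE x in lebesgue_on \<Omega>. weak_grad \<Omega> (\<lambda>x. c *\<^sub>R u x) x = c *\<^sub>R weak_grad \<Omega> u x"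
proof -
  \<comment> \<open>A multiple is written as a combination of u with itself, which reduces the claim
    to the previous lemma.\<close>
  have *: "v + (c - 1) *\<^sub>R v = c *\<^sub>R v" for v :: "'x::real_vector" by (simp add: algebra_simps)
  show "(\<lambda>x. c *\<^sub>R u x) \<in> W1p \<Omega> p"
    "AE x in lebesgue_on \<Omega>. weak_grad \<Omega> (\<lambda>x. c *\<^sub>R u x) x = c *\<^sub>R weak_grad \<Omega> u x"
    using W1p_add_scaleR[OF assms assms(3), of "c - 1"] by (simp_all add: *)
qed

lemma W1p_add:
  assumes "open \<Omega>" "0 \<le> p" "u \<in> W1p \<Omega> p" "v \<in> W1p \<Omega> p"
  shows "(\<lambda>x. u x + v x) \<in> W1p \<Omega> p"
    and "AE x in lebesgue_on \<Omega>. weak_grad \<Omega> (\<lambda>x. u x + v x) x = weak_grad \<Omega> u x + weak_grad \<Omega> v x"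
  using W1p_add_scaleR[OF assms, of 1] by simp_all

section \<open>Minors and pointwise estimates\<close>

lemma minor_size_pos: "0 < minor_size k"
  unfolding minor_size_def by transfer auto

lemma minor_size_le: "minor_size (k :: ('N::finite, 'n::finite) minor_index) \<le> min CARD('N) CARD('n)"
proof -
  have "card (minor_rows k) = card (minor_cols k)" by transfer auto
  then show ?thesis
    unfolding minor_size_def by (simp add: card_mono) (metis card_mono finite subset_UNIV)
qed

text \<open>Splitting off one factor gives a_j (P - Q) + t b_j P, where P is bounded by the product
  of the |a_i| + |b_i| since t \<le> 1. The factor t on the right makes difference quotients of
  minors bounded uniformly in t.\<close>

lemma prod_perturbation_bound:
  fixes a b :: "'i \<Rightarrow> real"
  assumes "finite I" "0 \<le> t" "t \<le> 1"
  shows "\<bar>(\<Prod>i\<in>I. a i + t * b i) - (\<Prod>i\<in>I. a i)\<bar> \<le> t * (\<Prod>i\<in>I. \<bar>a i\<bar> + \<bar>b i\<bar>)"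
  using \<open>finite I\<close>
proof (induction I rule: finite_induct)
  case empty
  then show ?case using assms by simp
next
  case (insert j I)
  let ?P = "\<Prod>i\<in>I. a i + t * b i" and ?Q = "\<Prod>i\<in>I. a i" and ?M = "\<Prod>i\<in>I. \<bar>a i\<bar> + \<bar>b i\<bar>"
  have "\<bar>a i + t * b i\<bar> \<le> \<bar>a i\<bar> + \<bar>b i\<bar>" for i
    using assms by (intro order_trans[OF abs_triangle_ineq] add_left_mono) (auto simp: abs_mult intro: mult_left_le_one_le)
  then have P: "\<bar>?P\<bar> \<le> ?M"
    unfolding abs_prod by (intro prod_mono) auto
  have "\<bar>(a j + t * b j) * ?P - a j * ?Q\<bar> = \<bar>a j * (?P - ?Q) + t * (b j * ?P)\<bar>"
    by (simp add: algebra_simps)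
  also have "\<dots> \<le> \<bar>a j\<bar> * \<bar>?P - ?Q\<bar> + t * (\<bar>b j\<bar> * \<bar>?P\<bar>)"
    using assms by (intro order_trans[OF abs_triangle_ineq]) (simp add: abs_mult)
  also have "\<dots> \<le> \<bar>a j\<bar> * (t * ?M) + t * (\<bar>b j\<bar> * ?M)"
    using assms insert.IH P by (intro add_mono mult_left_mono) auto
  also have "\<dots> = t * ((\<bar>a j\<bar> + \<bar>b j\<bar>) * ?M)"
    by (simp add: algebra_simps)
  finally show ?case using insert.hyps by simp
qed

lemma abs_entry_le_norm: "\<bar>(A :: real ^ 'n ^ 'm) $ i $ j\<bar> \<le> norm A"
  using component_le_norm_cart[of "A $ i" j] Finite_Cartesian_Product.norm_nth_le[of A i] by linarith

lemma abs_permutation_sum_le: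
  assumes "\<And>\<pi>. \<pi> permutes {..<s} \<Longrightarrow> \<bar>f \<pi>\<bar> \<le> M"
  shows "\<bar>\<Sum>\<pi> | \<pi> permutes {..<s::nat}. of_int (sign \<pi>) * f \<pi>\<bar> \<le> fact s * (M :: real)"
proof -
  have "\<bar>of_int (sign \<pi>) * f \<pi>\<bar> \<le> M" if "\<pi> permutes {..<s}" for \<pi>
    using assms[OF that] by (auto simp: abs_mult sign_def)
  then have "\<bar>\<Sum>\<pi> | \<pi> permutes {..<s}. of_int (sign \<pi>) * f \<pi>\<bar> \<le> (\<Sum>\<pi> | \<pi> permutes {..<s}. M)"
    by (intro order_trans[OF sum_abs] sum_mono) auto
  then show ?thesis by (simp add: card_permutations)
qed

text \<open>The factorial counts the permutations in the Leibniz formula; each product has as many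
  factors as the order of the minor, and each factor is at most the norm.\<close>

lemma abs_minor_le: "\<bar>minor A k\<bar> \<le> fact (minor_size k) * norm A ^ minor_size k"
  unfolding minor_def Let_def
proof (rule abs_permutation_sum_le)
  fix \<pi>
  show "\<bar>\<Prod>i<minor_size k. A $ (sorted_list_of_set (minor_rows k) ! i) $ (sorted_list_of_set (minor_cols k) ! \<pi> i)\<bar>
      \<le> norm A ^ minor_size k"
    unfolding abs_prod using prod_mono[of "{..<minor_size k}" _ "\<lambda>_. norm A"]
    by (simp add: abs_entry_le_norm)
qed

lemma abs_minor_diff_le:
  assumes "0 \<le> t" "t \<le> 1"
  shows "\<bar>minor (A + t *\<^sub>R B) k - minor A k\<bar> \<le>
    t * (fact (minor_size k) * (norm A + norm B) ^ minor_size k)"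
proof -
  let ?r = "sorted_list_of_set (minor_rows k)" and ?c = "sorted_list_of_set (minor_cols k)"
  let ?p = "\<lambda>A \<pi>. \<Prod>i<minor_size k. A $ (?r ! i) $ (?c ! \<pi> i)"
  have "\<bar>\<Sum>\<pi> | \<pi> permutes {..<minor_size k}. of_int (sign \<pi>) * (?p (A + t *\<^sub>R B) \<pi> - ?p A \<pi>)\<bar>
      \<le> fact (minor_size k) * (t * (norm A + norm B) ^ minor_size k)"
  proof (rule abs_permutation_sum_le)
    fix \<pi>
    have "\<bar>?p (A + t *\<^sub>R B) \<pi> - ?p A \<pi>\<bar> \<le>
        t * (\<Prod>i<minor_size k. \<bar>A $ (?r ! i) $ (?c ! \<pi> i)\<bar> + \<bar>B $ (?r ! i) $ (?c ! \<pi> i)\<bar>)"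
      unfolding vector_add_component vector_scaleR_component real_scaleR_def
      by (rule prod_perturbation_bound) (use assms in auto)
    also have "\<dots> \<le> t * (\<Prod>i<minor_size k. norm A + norm B)"
      using assms by (intro mult_left_mono prod_mono) (auto intro!: add_mono abs_entry_le_norm)
    finally show "\<bar>?p (A + t *\<^sub>R B) \<pi> - ?p A \<pi>\<bar> \<le> t * (norm A + norm B) ^ minor_size k"
      by simp
  qed
  then show ?thesis
    by (simp add: minor_def Let_def right_diff_distrib sum_subtractf mult.left_commute)
qed

lemma differentiable_prod:
  fixes f :: "'i \<Rightarrow> 'a::real_normed_vector \<Rightarrow> real"
  assumes "finite I" "\<And>i. i \<in> I \<Longrightarrow> f i differentiable (at x within S)"
  shows "(\<lambda>x. \<Prod>i\<in>I. f i x) differentiable (at x within S)"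
  using assms by (induction I rule: finite_induct) (auto intro: differentiable_mult)

lemma minor_differentiable:
  fixes A :: "('N::{finite,linorder}, 'n::{finite,linorder}) rmat"
  shows "(\<lambda>A. minor A k) differentiable (at A)"
proof -
  have "bounded_linear (\<lambda>A :: ('N, 'n) rmat. A $ i $ j)" for i :: 'N and j :: 'n
    by (intro bounded_linear_compose[OF bounded_linear_vec_nth] bounded_linear_vec_nth)
  then have *: "(\<lambda>A :: ('N, 'n) rmat. A $ i $ j) differentiable (at A)" for i :: 'N and j :: 'n and A
    by (rule bounded_linear_imp_differentiable)
  show ?thesis
    unfolding minor_def Let_def
    by (intro differentiable_sum ballI differentiable_mult differentiable_const differentiable_prod * )
      (auto simp: finite_permutations)
qed

lemma all_minors_differentiable: "all_minors differentiable (at A)"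
proof -
  have "((\<lambda>A. all_minors A $ k) has_derivative frechet_derivative (\<lambda>A. minor A k) (at A)) (at A)" for k
    using minor_differentiable by (simp add: all_minors_def frechet_derivative_works)
  then have "(all_minors has_derivative (\<lambda>B. \<chi> k. frechet_derivative (\<lambda>A. minor A k) (at A) B)) (at A)"
    by (subst has_derivative_componentwise_within) (auto simp: Basis_vec_def inner_axis)
  then show ?thesis by (auto simp: differentiable_def)
qed

section \<open>Gradients and functions along a segment\<close>

lemma gradient_works:
  fixes g :: "'a::euclidean_space \<Rightarrow> real"
  assumes "g differentiable (at y)"
  shows "(g has_derivative (\<lambda>h. h \<bullet> gradient g y)) (at y)"
proof -
  obtain g' where g': "(g has_derivative g') (at y)" using assms by (auto simp: differentiable_def)
  have "GDERIV g y :> adjoint g' 1"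
    using g' adjoint_works[OF has_derivative_linear[OF g'], of _ 1] by (simp add: gderiv_def)
  moreover have "D = E" if "GDERIV g y :> D" "GDERIV g y :> E" for D E
    using has_derivative_unique[OF that[unfolded gderiv_def]] by (simp add: fun_eq_iff vector_eq_ldot)
  ultimately have "GDERIV g y :> gradient g y"
    unfolding gradient_def by (metis theI)
  then show ?thesis by (simp add: gderiv_def)
qed

text \<open>A bound on the derivative keeps the function from escaping to infinity, so the open effective
  domain contains the whole segment.\<close>

lemma finite_along_segment:
  fixes \<phi> :: "'a::real_normed_vector \<Rightarrow> ennreal"
  assumes cont: "continuous_on UNIV \<phi>" and fin: "\<phi> y < \<infinity>"
    and D: "\<And>z. \<phi> z < \<infinity> \<Longrightarrow> ((\<lambda>z. enn2real (\<phi> z)) has_derivative D z) (at z)"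
    and bound: "\<And>s. 0 \<le> s \<Longrightarrow> s \<le> 1 \<Longrightarrow> \<phi> (y + s *\<^sub>R v) < \<infinity> \<Longrightarrow> \<bar>D (y + s *\<^sub>R v) v\<bar> \<le> M"
    and t: "0 \<le> t" "t \<le> 1"
  shows "\<phi> (y + t *\<^sub>R v) < \<infinity>" "\<bar>enn2real (\<phi> (y + t *\<^sub>R v)) - enn2real (\<phi> y)\<bar> \<le> t * M"
proof -
  let ?l = "\<lambda>s. y + s *\<^sub>R v"
  have lip: "\<bar>enn2real (\<phi> (?l s)) - enn2real (\<phi> y)\<bar> \<le> s * M"
    if s: "0 \<le> s" "s \<le> 1" and fin_s: "\<And>r. 0 \<le> r \<Longrightarrow> r \<le> s \<Longrightarrow> \<phi> (?l r) < \<infinity>" for s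
  proof -
    have "((\<lambda>r. enn2real (\<phi> (?l r))) has_field_derivative D (?l r) v) (at r within {0..s})"
      if "r \<in> {0..s}" for r
    proof -
      have Dr: "((\<lambda>z. enn2real (\<phi> z)) has_derivative D (?l r)) (at (?l r))"
        using that fin_s by (intro D) auto
      have "((\<lambda>r. enn2real (\<phi> (?l r))) has_derivative (\<lambda>x. D (?l r) (x *\<^sub>R v))) (at r within {0..s})"
        by (rule has_derivative_compose[of ?l, OF _ Dr]) (auto intro!: derivative_eq_intros)
      then show ?thesis
        using linear_scale[OF has_derivative_linear[OF Dr]]
        by (simp add: has_field_derivative_def mult_commute_abs)
    qed
    then have "norm (enn2real (\<phi> (?l s)) - enn2real (\<phi> (?l 0))) \<le> M * norm (s - 0)"
      by (rule field_differentiable_bound[rotated]) (use s fin_s bound in auto)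
    then show ?thesis using s by (simp add: mult.commute)
  qed
  have cont_l: "continuous_on UNIV (\<lambda>s. \<phi> (?l s))"
    by (rule continuous_on_compose2[OF cont]) (auto intro!: continuous_intros)
  have all_fin: "\<phi> (?l s) < \<infinity>" if "0 \<le> s" "s \<le> 1" for s
  proof (rule ccontr)
    assume "\<not> \<phi> (?l s) < \<infinity>"
    \<comment> \<open>By continuity into [0, \<infinity>] this set of parameters is closed, so it
      has a least element m. Before m the Lipschitz estimate keeps the values below a fixed finite
      number, and continuity from the left carries this bound to m, where the value should be
      infinite.\<close>
    define Bad where "Bad = {r\<in>{0..1}. \<phi> (?l r) \<in> {\<infinity>}}"
    have "Bad = {0..1} \<inter> (\<lambda>s. \<phi> (?l s)) -` {\<infinity>}"
      by (auto simp: Bad_def)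
    then have "closed Bad"
      using continuous_on_closed_vimage[of UNIV "\<lambda>s. \<phi> (?l s)"] cont_l by (auto intro!: closed_Int)
    moreover have "bounded Bad"
      by (rule bounded_subset[OF bounded_closed_interval[of 0 1]]) (auto simp: Bad_def)
    ultimately have "compact Bad" by (simp add: compact_eq_bounded_closed)
    moreover have "\<phi> (?l s) = \<infinity>"
      using \<open>\<not> \<phi> (?l s) < \<infinity>\<close> by (metis infinity_ennreal_def top.not_eq_extremum)
    then have "s \<in> Bad" using that by (simp add: Bad_def)
    ultimately obtain m where m: "m \<in> Bad" and min: "\<And>r. r \<in> Bad \<Longrightarrow> m \<le> r"
      using compact_attains_inf[of Bad] by blast
    have m01: "0 \<le> m" "m \<le> 1" "\<phi> (?l m) = \<infinity>" using m by (auto simp: Bad_def)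
    have "m \<noteq> 0" using m01 fin by auto
    then have "0 < m" using m01 by simp
    have below: "\<phi> (?l r) < \<infinity>" if "0 \<le> r" "r < m" for r
      using min[of r] that m01
      by (metis (mono_tags, lifting) Bad_def atLeastAtMost_iff infinity_ennreal_def insertI1
          less_eq_real_def mem_Collect_eq not_less order_trans top.not_eq_extremum)
    have M: "0 \<le> M" using bound[of 0] fin by (simp add: order_trans[OF abs_ge_zero])
    have le: "\<phi> (?l r) \<le> ennreal (enn2real (\<phi> y) + M)" if "0 \<le> r" "r < m" for r
    proof -
      have "\<bar>enn2real (\<phi> (?l r)) - enn2real (\<phi> y)\<bar> \<le> r * M"
        using that m01 by (intro lip below) auto
      moreover have "r * M \<le> M" using that m01 M by (intro mult_left_le_one_le) auto
      ultimately have "enn2real (\<phi> (?l r)) \<le> enn2real (\<phi> y) + M" by linarith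
      moreover have "\<phi> (?l r) = ennreal (enn2real (\<phi> (?l r)))"
        using below[OF that] by simp
      ultimately show ?thesis by (metis ennreal_leI)
    qed
    have "((\<lambda>s. \<phi> (?l s)) \<longlongrightarrow> \<phi> (?l m)) (at_left m)"
      using cont_l by (simp add: continuous_on_eq_continuous_at isCont_def filterlim_at_split)
    moreover have "\<forall>\<^sub>F r in at_left m. \<phi> (?l r) \<le> ennreal (enn2real (\<phi> y) + M)"
      using eventually_at_left_real[OF \<open>0 < m\<close>] by eventually_elim (auto intro: le)
    ultimately have "\<phi> (?l m) \<le> ennreal (enn2real (\<phi> y) + M)"
      by (rule tendsto_upperbound) simp
    then show False using m01 by (simp add: top_unique)
  qed
  show "\<phi> (?l t) < \<infinity>" using all_fin t by blast
  show "\<bar>enn2real (\<phi> (?l t)) - enn2real (\<phi> y)\<bar> \<le> t * M"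
    using t all_fin by (intro lip) auto
qed

section \<open>Measurability, one-sided dominated convergence and integrable products\<close>

lemma rpow_mono: "0 \<le> x \<Longrightarrow> x \<le> y \<Longrightarrow> 0 \<le> r \<Longrightarrow> rpow x r \<le> rpow y r"
  by (auto simp: rpow_def intro: powr_mono2)

lemma rpow_minus_one_mult: "0 \<le> z \<Longrightarrow> 1 \<le> p \<Longrightarrow> rpow z (p - 1) * z = z powr p"
  by (auto simp: rpow_def powr_diff)

lemma (in complete_measure) borel_measurable_AE_limit:
  fixes g :: "'a \<Rightarrow> real"
  assumes f: "\<And>i. f i \<in> borel_measurable M" and lim: "AE x in M. (\<lambda>i. f i x) \<longlonglongrightarrow> g x"
  shows "g \<in> borel_measurable M"
proof (rule measurable_cong_AE)
  show "(\<lambda>x. lim (\<lambda>i. f i x)) \<in> borel_measurable M" using f by (rule borel_measurable_lim_metric)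
  show "AE x in M. lim (\<lambda>i. f i x) = g x" using lim by eventually_elim (rule limI)
qed simp

text \<open>A limit from the right is tested along sequences in (0, 1), to which the sequential
  theorem applies. Measurability of the limit g is not assumed: it follows from one such sequence
  and completeness.\<close>

lemma (in complete_measure) dominated_convergence_at_right:
  fixes s :: "real \<Rightarrow> 'a \<Rightarrow> real"
  assumes meas: "\<And>t. 0 < t \<Longrightarrow> t < 1 \<Longrightarrow> s t \<in> borel_measurable M"
    and bound: "\<And>t. 0 < t \<Longrightarrow> t < 1 \<Longrightarrow> AE x in M. \<bar>s t x\<bar> \<le> w x"
    and w: "integrable M w"
    and lim: "AE x in M. ((\<lambda>t. s t x) \<longlongrightarrow> g x) (at_right 0)"
  shows "integrable M g" "((\<lambda>t. LINT x|M. s t x) \<longlongrightarrow> (LINT x|M. g x)) (at_right 0)"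
proof -
  have lim_seq: "AE x in M. (\<lambda>i. s (S i) x) \<longlonglongrightarrow> g x"
    if "\<And>n. 0 < S n" "S \<longlonglongrightarrow> 0" for S :: "nat \<Rightarrow> real"
  proof -
    have "filterlim S (at_right 0) sequentially"
      using that by (simp add: filterlim_at less_imp_neq[THEN not_sym])
    with lim show ?thesis
      by (auto elim!: eventually_mono intro: filterlim_compose)
  qed
  \<comment> \<open>The shift by two keeps the whole sequence, including its first term, strictly
    below 1.\<close>
  define r :: "nat \<Rightarrow> real" where "r i = inverse (real (Suc (Suc i)))" for i
  have r: "0 < r i" "r i < 1" for i by (auto simp: r_def field_simps)
  have r_lim: "r \<longlonglongrightarrow> 0"
    unfolding r_def using LIMSEQ_inverse_real_of_nat by (rule LIMSEQ_Suc)
  have g: "g \<in> borel_measurable M"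
    by (rule borel_measurable_AE_limit[OF _ lim_seq[OF r(1) r_lim]]) (intro meas r)
  show "integrable M g"
    by (rule integrable_dominated_convergence[where s = "\<lambda>i. s (r i)" and w = w])
      (use g w meas r bound lim_seq[OF r(1) r_lim] in auto)
  show "((\<lambda>t. LINT x|M. s t x) \<longlongrightarrow> (LINT x|M. g x)) (at_right 0)"
  proof (rule tendsto_at_right_sequentially[of 0 1])
    fix S :: "nat \<Rightarrow> real"
    assume S: "\<And>n. 0 < S n" "\<And>n. S n < 1" "S \<longlonglongrightarrow> 0"
    show "(\<lambda>n. LINT x|M. s (S n) x) \<longlonglongrightarrow> (LINT x|M. g x)"
      by (rule integral_dominated_convergence[where w = w])
        (use g w meas S bound lim_seq[OF S(1,3)] in auto)
  qed simp
qed

text \<open>Since F is measurable in x only for fixed remaining arguments, the pair (u, \<xi>) is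
  approximated pointwise by simple functions. With finitely many values the composition is
  measurable, and continuity for almost every x passes to the limit.\<close>

lemma caratheodory_measurable:
  assumes F: "caratheodory \<Omega> F" and \<Omega>: "\<Omega> \<in> sets lebesgue"
    and u: "u \<in> borel_measurable (lebesgue_on \<Omega>)" and \<xi>: "\<xi> \<in> borel_measurable (lebesgue_on \<Omega>)"
  shows "(\<lambda>x. F x (u x :: 'a::euclidean_space) (\<xi> x :: 'b::euclidean_space)) \<in> borel_measurable (lebesgue_on \<Omega>)"
proof -
  let ?M = "lebesgue_on \<Omega>"
  interpret complete_measure ?M using \<Omega> by (rule complete_measure_lebesgue_on)
  have "(\<lambda>x. (u x, \<xi> x)) \<in> borel_measurable ?M" using u \<xi> by simp
  from borel_measurable_implies_sequence_metric[OF this, of undefined]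
  obtain s where s: "\<And>i. simple_function ?M (s i)"
    and s_lim: "\<And>x. x \<in> space ?M \<Longrightarrow> (\<lambda>i. s i x) \<longlonglongrightarrow> (u x, \<xi> x)"
    by blast
  have meas: "(\<lambda>x. case s i x of (y, \<eta>) \<Rightarrow> F x y \<eta>) \<in> borel_measurable ?M" for i
  proof (rule measurable_compose_countable'[where I = "s i ` space ?M" and f = "\<lambda>z x. case z of (y, \<eta>) \<Rightarrow> F x y \<eta>"])
    have fin: "finite (s i ` space ?M)" using s by (rule simple_functionD)
    then show "countable (s i ` space ?M)" by (rule countable_finite)
    show "s i \<in> ?M \<rightarrow>\<^sub>M count_space (s i ` space ?M)"
      using fin simple_functionD(2)[OF s] by (simp add: measurable_count_space_eq2)
    show "(\<lambda>x. case z of (y, \<eta>) \<Rightarrow> F x y \<eta>) \<in> borel_measurable ?M" for z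
      using F by (cases z) (simp add: caratheodory_def)
  qed
  show ?thesis
  proof (rule measurable_cong_AE)
    \<comment> \<open>The lower limit is measurable regardless of convergence at the exceptional
      points; completeness covers those.\<close>
    show "(\<lambda>x. liminf (\<lambda>i. case s i x of (y, \<eta>) \<Rightarrow> F x y \<eta>)) \<in> borel_measurable ?M"
      using meas by (rule borel_measurable_liminf)
    have "AE x in ?M. continuous_on UNIV (\<lambda>(y, \<eta>). F x y \<eta>)"
      using F by (simp add: caratheodory_def)
    then show "AE x in ?M. liminf (\<lambda>i. case s i x of (y, \<eta>) \<Rightarrow> F x y \<eta>) = F x (u x) (\<xi> x)"
      using AE_space
    proof eventually_elim
      case (elim x)
      have "(\<lambda>i. (\<lambda>(y, \<eta>). F x y \<eta>) (s i x)) \<longlonglongrightarrow> (\<lambda>(y, \<eta>). F x y \<eta>) (u x, \<xi> x)"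
        by (rule continuous_on_tendsto_compose[OF elim(1) s_lim[OF elim(2)]]) auto
      then show ?case by (intro lim_imp_Liminf) auto
    qed
  qed simp
qed

text \<open>Only integrability is wanted, so Young's pointwise inequality suffices when r > 1; for r
  = 1 the conjugate exponent is infinite and f is essentially bounded.\<close>

lemma Lspace_holder_integrable:
  fixes g :: "'a::euclidean_space \<Rightarrow> real"
  assumes f: "f \<in> Lspace \<Omega> (holder_conj r)" and g: "g \<in> Lspace \<Omega> (ereal r)" and "1 \<le> r"
  shows "integrable (lebesgue_on \<Omega>) (\<lambda>x. norm (f x) * norm (g x))"
proof -
  have [measurable]: "f \<in> borel_measurable (lebesgue_on \<Omega>)" "g \<in> borel_measurable (lebesgue_on \<Omega>)"
    and gi: "integrable (lebesgue_on \<Omega>) (\<lambda>x. norm (g x) powr r)"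
    using f g by (auto simp: Lspace_def)
  have meas: "(\<lambda>x. norm (f x) * norm (g x)) \<in> borel_measurable (lebesgue_on \<Omega>)" by measurable
  show ?thesis
  proof (cases "r = 1")
    case True
    then obtain C where C: "AE x in lebesgue_on \<Omega>. norm (f x) \<le> C"
      using f by (auto simp: Lspace_def holder_conj_def)
    show ?thesis
    proof (rule Bochner_Integration.integrable_bound[OF _ meas])
      show "integrable (lebesgue_on \<Omega>) (\<lambda>x. C * norm (g x))" using gi True by simp
      show "AE x in lebesgue_on \<Omega>. norm (norm (f x) * norm (g x)) \<le> norm (C * norm (g x))"
        using C by eventually_elim (auto simp: abs_mult intro!: mult_right_mono)
    qed
  next
    case False
    let ?q = "r / (r - 1)"
    have r: "1 < r" using False assms by simp
    then have fi: "integrable (lebesgue_on \<Omega>) (\<lambda>x. norm (f x) powr ?q)"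
      using f by (simp add: holder_conj_def Lspace_ereal)
    have "norm (f x) * norm (g x) \<le> norm (f x) powr ?q / ?q + norm (g x) powr r / r" for x
      using r by (intro Youngs_inequality) (auto simp: field_simps)
    then show ?thesis
      using fi gi r by (intro Bochner_Integration.integrable_bound[OF _ meas,
            of "\<lambda>x. norm (f x) powr ?q / ?q + norm (g x) powr r / r"]) auto
  qed
qed

lemma Lspace_power:
  fixes g :: "'a::euclidean_space \<Rightarrow> real"
  assumes g: "g \<in> Lspace \<Omega> (ereal p)" and nonneg: "\<And>x. 0 \<le> g x" and "0 < s"
  shows "(\<lambda>x. g x ^ s) \<in> Lspace \<Omega> (ereal (p / real s))"
proof -
  have "(g x ^ s) powr (p / real s) = g x powr p" for x
    using nonneg[of x] \<open>0 < s\<close> by (cases "g x = 0") (auto simp: powr_powr simp flip: powr_realpow)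
  then show ?thesis using g nonneg by (auto simp: Lspace_ereal)
qed

lemma directional_derivative_at_right:
  fixes g :: "'a::real_normed_vector \<Rightarrow> real"
  assumes "(g has_derivative D) (at z)"
  shows "((\<lambda>t. (g (z + t *\<^sub>R v) - g z) / t) \<longlongrightarrow> D v) (at_right 0)"
proof -
  have "((\<lambda>t. g (z + t *\<^sub>R v)) has_derivative (\<lambda>t. D (t *\<^sub>R v))) (at 0)"
    by (rule has_derivative_compose[of "\<lambda>t. z + t *\<^sub>R v"]) (use assms in \<open>auto intro!: derivative_eq_intros\<close>)
  then have "((\<lambda>t. g (z + t *\<^sub>R v)) has_field_derivative D v) (at 0)"
    using linear_scale[OF has_derivative_linear[OF assms]]
    by (simp add: has_field_derivative_def mult_commute_abs)
  then show ?thesis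
    by (simp add: has_field_derivative_iff filterlim_at_split)
qed

lemma continuous_all_minors: "continuous_on UNIV all_minors"
  by (intro continuous_at_imp_continuous_on ballI differentiable_imp_continuous_within all_minors_differentiable)

text \<open>The situation at one point x, with e standing for a(x). Z dominates the norms of u + s
  h, A + s B and (h, B) for all s in [0, 1], so Cauchy-Schwarz and the growth condition bound the
  slope by |e| Z + (b + c) Z^(p-1) Z. That bound uses the gradient of the composition with the
  minors; the limit uses the gradient of F itself, linked to it by the chain rule.\<close>

lemma polyconvex_pointwise:
  fixes F1 :: "'N::{finite,linorder} rvec \<Rightarrow> ('N, 'n::{finite,linorder}) minor_index rvec \<Rightarrow> ennreal"
  defines "g \<equiv> \<lambda>(y, B). enn2real (F1 y (all_minors B))"
  assumes cont: "continuous_on UNIV (\<lambda>(y, \<eta>). F1 y \<eta>)"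
    and diff: "differentiable_on_domain (\<lambda>(y, \<eta>). F1 y \<eta>)"
    and growth: "\<forall>y B. F1 y (all_minors B) < \<infinity> \<longrightarrow>
      norm (gradient g (y, B)) \<le> e + b * rpow (norm y) (p - 1) + c * rpow (norm B) (p - 1)"
    and fin: "F1 u (all_minors A) < \<infinity>" and p: "1 \<le> p" and bc: "0 \<le> b" "0 \<le> c"
    and Z: "Z = norm u + norm h + norm A + norm B"
  shows "0 \<le> t \<Longrightarrow> t \<le> 1 \<Longrightarrow> F1 (u + t *\<^sub>R h) (all_minors (A + t *\<^sub>R B)) < \<infinity>"
    and "0 \<le> t \<Longrightarrow> t \<le> 1 \<Longrightarrow> \<bar>g (u + t *\<^sub>R h, A + t *\<^sub>R B) - g (u, A)\<bar> \<le> t * (\<bar>e\<bar> * Z + (b + c) * Z powr p)"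
    and "((\<lambda>t. (g (u + t *\<^sub>R h, A + t *\<^sub>R B) - g (u, A)) / t) \<longlongrightarrow>
      (h, frechet_derivative all_minors (at A) B) \<bullet> gradient (\<lambda>(y, \<eta>). enn2real (F1 y \<eta>)) (u, all_minors A))
      (at_right 0)"
proof -
  define \<phi> where "\<phi> = (\<lambda>(y, B). F1 y (all_minors B))"
  let ?G = "\<lambda>(y, \<eta>). enn2real (F1 y \<eta>)"
  have g_eq: "g = (\<lambda>z. enn2real (\<phi> z))" by (auto simp: g_def \<phi>_def)
  have cont_\<phi>: "continuous_on UNIV \<phi>"
    unfolding \<phi>_def case_prod_beta
    by (rule continuous_on_compose2[OF cont, of UNIV "\<lambda>z. (fst z, all_minors (snd z))", unfolded case_prod_beta fst_conv snd_conv])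
      (auto intro!: continuous_intros continuous_on_compose2[OF continuous_all_minors])
  have chain: "(g has_derivative (\<lambda>(k, C). (k, frechet_derivative all_minors (at B) C) \<bullet> gradient ?G (y, all_minors B))) (at (y, B))"
    if "F1 y (all_minors B) < \<infinity>" for y B
  proof -
    have "?G = (\<lambda>z. enn2real ((\<lambda>(y, \<eta>). F1 y \<eta>) z))" by auto
    then have "?G differentiable (at (y, all_minors B))"
      using diff[unfolded differentiable_on_domain_def, rule_format, of "(y, all_minors B)"] that by simp
    then have G: "(?G has_derivative (\<lambda>k. k \<bullet> gradient ?G (y, all_minors B))) (at (y, all_minors B))"
      by (rule gradient_works)
    have T: "(all_minors has_derivative frechet_derivative all_minors (at B)) (at (snd (y, B)))"
      using all_minors_differentiable by (simp add: frechet_derivative_works)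
    have "((\<lambda>z. all_minors (snd z)) has_derivative (\<lambda>k. frechet_derivative all_minors (at B) (snd k))) (at (y, B))"
      by (rule has_derivative_compose[of snd, OF _ T]) (auto intro!: derivative_eq_intros)
    then have "((\<lambda>z. (fst z, all_minors (snd z))) has_derivative
        (\<lambda>k. (fst k, frechet_derivative all_minors (at B) (snd k)))) (at (y, B))"
      by (intro has_derivative_Pair) (auto intro!: derivative_eq_intros)
    then have "((\<lambda>z. ?G (fst z, all_minors (snd z))) has_derivative
        (\<lambda>k. (fst k, frechet_derivative all_minors (at B) (snd k)) \<bullet> gradient ?G (y, all_minors B))) (at (y, B))"
      by (rule has_derivative_compose) (use G in simp)
    then show ?thesis
      by (simp add: g_def case_prod_beta')
  qed
  let ?y = "(u, A)" and ?v = "(h, B)"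
  have D: "((\<lambda>z. enn2real (\<phi> z)) has_derivative (\<lambda>k. k \<bullet> gradient g z)) (at z)" if "\<phi> z < \<infinity>" for z
    unfolding g_eq[symmetric]
    using that chain[of "fst z" "snd z"] by (intro gradient_works) (auto simp: \<phi>_def case_prod_beta differentiable_def)
  have bound: "\<bar>?v \<bullet> gradient g (?y + s *\<^sub>R ?v)\<bar> \<le> \<bar>e\<bar> * Z + (b + c) * Z powr p"
    if s: "0 \<le> s" "s \<le> 1" and fin_s: "\<phi> (?y + s *\<^sub>R ?v) < \<infinity>" for s
  proof -
    have le: "norm (x + s *\<^sub>R y) \<le> norm x + norm y" for x y :: "'z::real_normed_vector"
      using s by (intro order_trans[OF norm_triangle_ineq] add_left_mono) (simp add: mult_left_le_one_le)
    have "norm (u + s *\<^sub>R h) \<le> Z" "norm (A + s *\<^sub>R B) \<le> Z"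
      using le[of u h] le[of A B] norm_ge_zero[of u] norm_ge_zero[of h] norm_ge_zero[of A] norm_ge_zero[of B]
      unfolding Z by linarith+
    then have "b * rpow (norm (u + s *\<^sub>R h)) (p - 1) \<le> b * rpow Z (p - 1)"
      "c * rpow (norm (A + s *\<^sub>R B)) (p - 1) \<le> c * rpow Z (p - 1)"
      using p bc by (auto intro!: mult_left_mono rpow_mono)
    then have grad: "norm (gradient g (?y + s *\<^sub>R ?v)) \<le> \<bar>e\<bar> + (b + c) * rpow Z (p - 1)"
      using growth[rule_format, of "u + s *\<^sub>R h" "A + s *\<^sub>R B"] fin_s by (simp add: \<phi>_def algebra_simps)
    have "norm ?v \<le> Z"
      using norm_Pair_le[of h B] norm_ge_zero[of u] norm_ge_zero[of A] unfolding Z by linarith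
    moreover have "0 \<le> Z" by (simp add: Z)
    ultimately have "norm ?v * norm (gradient g (?y + s *\<^sub>R ?v)) \<le> Z * (\<bar>e\<bar> + (b + c) * rpow Z (p - 1))"
      using grad by (intro mult_mono) auto
    also have "\<dots> = \<bar>e\<bar> * Z + (b + c) * (rpow Z (p - 1) * Z)"
      by (simp add: algebra_simps)
    finally show ?thesis
      using Cauchy_Schwarz_ineq2[of ?v "gradient g (?y + s *\<^sub>R ?v)"] rpow_minus_one_mult[of Z p] p \<open>0 \<le> Z\<close>
      by simp
  qed
  have fin': "\<phi> ?y < \<infinity>" using fin by (simp add: \<phi>_def)
  have seg: "\<phi> (?y + t *\<^sub>R ?v) < \<infinity>"
    "\<bar>enn2real (\<phi> (?y + t *\<^sub>R ?v)) - enn2real (\<phi> ?y)\<bar> \<le> t * (\<bar>e\<bar> * Z + (b + c) * Z powr p)"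
    if "0 \<le> t" "t \<le> 1" for t
    by (rule finite_along_segment[OF cont_\<phi> fin' _ _ that], erule D, erule (2) bound)+
  show "F1 (u + t *\<^sub>R h) (all_minors (A + t *\<^sub>R B)) < \<infinity>" if "0 \<le> t" "t \<le> 1"
    using seg(1)[OF that] by (simp add: \<phi>_def)
  show "\<bar>g (u + t *\<^sub>R h, A + t *\<^sub>R B) - g (u, A)\<bar> \<le> t * (\<bar>e\<bar> * Z + (b + c) * Z powr p)" if "0 \<le> t" "t \<le> 1"
    using seg(2)[OF that] by (simp add: g_eq)
  show "((\<lambda>t. (g (u + t *\<^sub>R h, A + t *\<^sub>R B) - g (u, A)) / t) \<longlongrightarrow>
      (h, frechet_derivative all_minors (at A) B) \<bullet> gradient ?G (u, all_minors A)) (at_right 0)"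
    using directional_derivative_at_right[OF chain[OF fin], of ?v] by simp
qed

section \<open>Variations of polyconvex functionals\<close>

text \<open>The part of the argument that concerns R and w alone; \<open>u\<close> is the point of
  differentiation, later \<open>u_dag\<close>.\<close>

locale polyconvex_growth =
  fixes \<Omega> :: "'n::{finite,linorder} rvec set" and p b c :: real
    and F :: "'n rvec \<Rightarrow> 'N::{finite,linorder} rvec \<Rightarrow> ('N, 'n) minor_index rvec \<Rightarrow> ennreal"
    and u :: "'n rvec \<Rightarrow> 'N rvec" and a :: "'n rvec \<Rightarrow> real"
    and Fu :: "'n rvec \<Rightarrow> 'N rvec" and F\<xi> :: "'n rvec \<Rightarrow> ('N, 'n) minor_index rvec"
  assumes open_\<Omega>: "open \<Omega>" and p: "1 \<le> p" "real (min CARD('N) CARD('n)) \<le> p"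
    and F: "caratheodory \<Omega> F"
    and diff: "AE x in lebesgue_on \<Omega>. differentiable_on_domain (\<lambda>(u, \<xi>). F x u \<xi>)"
    and u: "u \<in> W1p \<Omega> p" and fin: "polyconvex_functional \<Omega> F u < \<infinity>"
    and a: "a \<in> Lspace \<Omega> (holder_conj p)" and bc: "0 \<le> b" "0 \<le> c"
    and growth: "AE x in lebesgue_on \<Omega>. \<forall>u A. polyconvex_integrand F x u A < \<infinity> \<longrightarrow>
      norm (grad_joint (polyconvex_integrand F) x u A) \<le>
        a x + b * rpow (norm u) (p - 1) + c * rpow (norm A) (p - 1)"
    and Fu_def: "Fu = (\<lambda>x. fst (grad_joint F x (u x) (all_minors (weak_grad \<Omega> u x))))"
    and F\<xi>_def: "F\<xi> = (\<lambda>x. snd (grad_joint F x (u x) (all_minors (weak_grad \<Omega> u x))))"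
    and Fu: "Fu \<in> Lspace \<Omega> (holder_conj p)" and F\<xi>: "F\<xi> \<in> S_dual \<Omega> p"
begin

abbreviation M :: "'n rvec measure" where "M \<equiv> lebesgue_on \<Omega>"

abbreviation A :: "'n rvec \<Rightarrow> ('N, 'n) rmat" where "A \<equiv> weak_grad \<Omega> u"

definition Z :: "('n rvec \<Rightarrow> 'N rvec) \<Rightarrow> 'n rvec \<Rightarrow> real" where
  "Z h x = norm (u x) + norm (h x) + norm (A x) + norm (weak_grad \<Omega> h x)"

text \<open>By the chain rule this is the pointwise limit of the difference quotients of both
  integrands, that of R and that of w.\<close>

definition variation_integrand :: "('n rvec \<Rightarrow> 'N rvec) \<Rightarrow> 'n rvec \<Rightarrow> real" where
  "variation_integrand h x =
    Fu x \<bullet> h x + F\<xi> x \<bullet> frechet_derivative all_minors (at (A x)) (weak_grad \<Omega> h x)"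

definition variation :: "('n rvec \<Rightarrow> 'N rvec) \<Rightarrow> real" where
  "variation h = (LINT x|M. variation_integrand h x)"

lemma \<Omega>_lebesgue: "\<Omega> \<in> sets lebesgue"
  using open_\<Omega> by (simp add: borel_open)

sublocale complete_measure M
  using \<Omega>_lebesgue by (rule complete_measure_lebesgue_on)

lemma W1p_measurable:
  assumes "h \<in> W1p \<Omega> p"
  shows "h \<in> borel_measurable M" "weak_grad \<Omega> h \<in> borel_measurable M"
  using W1pD[OF open_\<Omega> assms] by (auto simp: Lspace_ereal)

lemma all_minors_measurable: "g \<in> borel_measurable M \<Longrightarrow> (\<lambda>x. all_minors (g x)) \<in> borel_measurable M"
  by (rule measurable_compose[OF _ borel_measurable_continuous_onI[OF continuous_all_minors]])

lemma Z_Lspace: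
  assumes "h \<in> W1p \<Omega> p"
  shows "Z h \<in> Lspace \<Omega> (ereal p)"
  unfolding Z_def[abs_def] using W1pD[OF open_\<Omega> u] W1pD[OF open_\<Omega> assms] p
  by (auto intro!: Lspace_add Lspace_norm)

lemma Z_nonneg: "0 \<le> Z h x"
  by (simp add: Z_def)

lemma dominating_integrable:
  assumes "h \<in> W1p \<Omega> p"
  shows "integrable M (\<lambda>x. \<bar>a x\<bar> * Z h x + (b + c) * Z h x powr p)"
  using Lspace_holder_integrable[OF a Z_Lspace[OF assms] p(1)] Z_Lspace[OF assms]
  by (auto simp: Lspace_ereal Z_nonneg)

lemma finite_at_u: "AE x in M. F x (u x) (all_minors (A x)) < \<infinity>"
proof -
  have "(\<lambda>x. F x (u x) (all_minors (A x))) \<in> borel_measurable M"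
    using W1p_measurable[OF u] by (intro caratheodory_measurable[OF F \<Omega>_lebesgue] all_minors_measurable)
  then have "AE x in M. F x (u x) (all_minors (A x)) \<noteq> \<infinity>"
    using fin unfolding polyconvex_functional_def by (intro nn_integral_PInf_AE) auto
  then show ?thesis by (simp add: less_top)
qed

text \<open>The weak gradient of u + t h is replaced by the combination of two fixed gradients. They
  agree only off a null set depending on t, whereas the limit at fixed x needs one null set for all
  t.\<close>

definition along :: "('n rvec \<Rightarrow> 'N rvec) \<Rightarrow> real \<Rightarrow> 'n rvec \<Rightarrow> real" where
  "along h t x = enn2real (F x (u x + t *\<^sub>R h x) (all_minors (A x + t *\<^sub>R weak_grad \<Omega> h x)))"

lemma along_AE:
  "AE x in M.
    (\<forall>t. 0 \<le> t \<longrightarrow> t \<le> 1 \<longrightarrow> F x (u x + t *\<^sub>R h x) (all_minors (A x + t *\<^sub>R weak_grad \<Omega> h x)) < \<infinity> \<and>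
      \<bar>along h t x - along h 0 x\<bar> \<le> t * (\<bar>a x\<bar> * Z h x + (b + c) * Z h x powr p)) \<and>
    ((\<lambda>t. (along h t x - along h 0 x) / t) \<longlongrightarrow> variation_integrand h x) (at_right 0)"
proof -
  have "AE x in M. continuous_on UNIV (\<lambda>(u, \<xi>). F x u \<xi>)"
    using F by (simp add: caratheodory_def)
  then show ?thesis
    using diff growth finite_at_u
  proof eventually_elim
    case (elim x)
    let ?g = "\<lambda>(y, B). enn2real (F x y (all_minors B))"
    have "\<forall>y B. F x y (all_minors B) < \<infinity> \<longrightarrow>
        norm (gradient ?g (y, B)) \<le> a x + b * rpow (norm y) (p - 1) + c * rpow (norm B) (p - 1)"
      using elim(3) by (simp add: polyconvex_integrand_def grad_joint_def)
    note pw = polyconvex_pointwise[OF elim(1,2) this elim(4) p(1) bc Z_def[of h x]]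
    have var: "variation_integrand h x = (h x, frechet_derivative all_minors (at (A x)) (weak_grad \<Omega> h x)) \<bullet>
        gradient (\<lambda>(y, \<eta>). enn2real (F x y \<eta>)) (u x, all_minors (A x))"
      unfolding variation_integrand_def
      by (simp add: Fu_def F\<xi>_def grad_joint_def inner_prod_def inner_commute)
    show ?case
    proof (intro conjI allI impI)
      fix t :: real assume t: "0 \<le> t" "t \<le> 1"
      show "F x (u x + t *\<^sub>R h x) (all_minors (A x + t *\<^sub>R weak_grad \<Omega> h x)) < \<infinity>"
        by (rule pw(1)[OF t])
      show "\<bar>along h t x - along h 0 x\<bar> \<le> t * (\<bar>a x\<bar> * Z h x + (b + c) * Z h x powr p)"
        using pw(2)[OF t] by (simp add: along_def)
    next
      show "((\<lambda>t. (along h t x - along h 0 x) / t) \<longlongrightarrow> variation_integrand h x) (at_right 0)"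
        using pw(3) by (simp add: along_def var)
    qed
  qed
qed

lemma along_measurable:
  assumes h: "h \<in> W1p \<Omega> p"
  shows "along h t \<in> borel_measurable M"
  unfolding along_def[abs_def]
  using W1p_measurable[OF u] W1p_measurable[OF h]
  by (intro borel_measurable_enn2real caratheodory_measurable[OF F \<Omega>_lebesgue] all_minors_measurable) auto

lemma functional_along:
  assumes h: "h \<in> W1p \<Omega> p" and t: "0 \<le> t" "t \<le> 1"
  shows "polyconvex_functional \<Omega> F (\<lambda>x. u x + t *\<^sub>R h x) = (\<integral>\<^sup>+x. ennreal (along h t x) \<partial>M)"
proof -
  have "AE x in M. F x (u x + t *\<^sub>R h x) (all_minors (weak_grad \<Omega> (\<lambda>x. u x + t *\<^sub>R h x) x)) = ennreal (along h t x)"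
    using along_AE[of h] W1p_add_scaleR(2)[OF open_\<Omega> _ u h, of t] p
    by (auto elim!: eventually_elim2 simp: along_def t)
  then show ?thesis
    unfolding polyconvex_functional_def by (rule nn_integral_cong_AE)
qed

text \<open>At t = 0 this is finiteness of the functional at u; the increment up to t has an
  integrable bound.\<close>

lemma along_integrable:
  assumes h: "h \<in> W1p \<Omega> p" and t: "0 \<le> t" "t \<le> 1"
  shows "integrable M (along h t)"
proof -
  have "(\<integral>\<^sup>+x. ennreal (along h 0 x) \<partial>M) < \<infinity>"
    using functional_along[OF h, of 0] fin by simp
  then have 0: "integrable M (along h 0)"
    using along_measurable[OF h] by (intro integrableI_nonneg) (auto simp: along_def)
  show ?thesis
  proof (rule Bochner_Integration.integrable_bound[OF _ along_measurable[OF h]])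
    show "integrable M (\<lambda>x. along h 0 x + t * (\<bar>a x\<bar> * Z h x + (b + c) * Z h x powr p))"
      using 0 dominating_integrable[OF h] by simp
    show "AE x in M. norm (along h t x) \<le> norm (along h 0 x + t * (\<bar>a x\<bar> * Z h x + (b + c) * Z h x powr p))"
      using along_AE[of h]
    proof eventually_elim
      case (elim x)
      then have "\<bar>along h t x - along h 0 x\<bar> \<le> t * (\<bar>a x\<bar> * Z h x + (b + c) * Z h x powr p)"
        using t by blast
      moreover have "0 \<le> along h t x" by (simp add: along_def)
      ultimately show ?case by simp
    qed
  qed
qed

lemma functional_finite:
  assumes h: "h \<in> W1p \<Omega> p" and t: "0 \<le> t" "t \<le> 1"
  shows "polyconvex_functional \<Omega> F (\<lambda>x. u x + t *\<^sub>R h x) = ennreal (LINT x|M. along h t x)"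
  unfolding functional_along[OF assms]
  by (intro nn_integral_eq_integral along_integrable[OF assms]) (simp add: along_def)

lemma variation_integrable: "h \<in> W1p \<Omega> p \<Longrightarrow> integrable M (variation_integrand h)"
  and functional_diff_quotient: "h \<in> W1p \<Omega> p \<Longrightarrow>
    (diff_quotient (\<lambda>v. enn2real (polyconvex_functional \<Omega> F v)) u h \<longlongrightarrow> variation h) (at_right 0)"
proof -
  assume h: "h \<in> W1p \<Omega> p"
  let ?s = "\<lambda>t x. (along h t x - along h 0 x) / t"
  have meas: "?s t \<in> borel_measurable M" for t
    using along_measurable[OF h] by measurable
  have bound: "AE x in M. \<bar>?s t x\<bar> \<le> \<bar>a x\<bar> * Z h x + (b + c) * Z h x powr p" if "0 < t" "t < 1" for t
    using along_AE[of h]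
  proof eventually_elim
    case (elim x)
    then have "\<bar>along h t x - along h 0 x\<bar> \<le> t * (\<bar>a x\<bar> * Z h x + (b + c) * Z h x powr p)"
      using that by auto
    then show ?case using that by (simp add: field_simps)
  qed
  have lim: "AE x in M. ((\<lambda>t. ?s t x) \<longlongrightarrow> variation_integrand h x) (at_right 0)"
    using along_AE[of h] by eventually_elim blast
  note dct = dominated_convergence_at_right[where s = ?s, OF meas bound dominating_integrable[OF h] lim]
  show "integrable M (variation_integrand h)" by (rule dct(1))
  have "\<forall>\<^sub>F t in at_right 0. (LINT x|M. ?s t x) = diff_quotient (\<lambda>v. enn2real (polyconvex_functional \<Omega> F v)) u h t"
    using eventually_at_right_real[of 0 1, OF zero_less_one]
  proof eventually_elim
    case (elim t)
    have nonneg: "0 \<le> (LINT x|M. along h t x)" for t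
      by (intro integral_nonneg_AE) (simp add: along_def)
    show ?case
      using elim functional_finite[OF h, of t] functional_finite[OF h, of 0] along_integrable[OF h, of t]
        along_integrable[OF h, of 0] nonneg
      by (simp add: diff_quotient_def)
  qed
  then show "(diff_quotient (\<lambda>v. enn2real (polyconvex_functional \<Omega> F v)) u h \<longlongrightarrow> variation h) (at_right 0)"
    using dct(2) unfolding variation_def by (rule Lim_transform_eventually[rotated])
qed

section \<open>Difference quotients of the subgradient w\<close>

lemma F\<xi>_measurable: "F\<xi> \<in> borel_measurable M"
  using F\<xi> by (subst borel_measurable_euclidean_space)
    (auto simp: S_dual_def Lspace_def Basis_vec_def inner_axis)

text \<open>A minor of order s is bounded by s! Z^s. As Z lies in L^p, Z^s lies in L^(p/s) and pairs
  with the component of \<open>F\<xi>\<close> in the dual space.\<close>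

definition minor_majorant :: "('n rvec \<Rightarrow> 'N rvec) \<Rightarrow> 'n rvec \<Rightarrow> real" where
  "minor_majorant h x = (\<Sum>k\<in>UNIV. \<bar>F\<xi> x $ k\<bar> * (fact (minor_size k) * Z h x ^ minor_size k))"

lemma minor_majorant_integrable:
  assumes h: "h \<in> W1p \<Omega> p"
  shows "integrable M (minor_majorant h)"
  unfolding minor_majorant_def[abs_def]
proof (intro Bochner_Integration.integrable_sum)
  fix k :: "('N, 'n) minor_index"
  have k: "0 < minor_size k" "real (minor_size k) \<le> p"
    using minor_size_pos[of k] minor_size_le[of k] p(2) by (auto simp: of_nat_le_iff intro: order_trans)
  have "integrable M (\<lambda>x. norm (F\<xi> x $ k) * norm (Z h x ^ minor_size k))"
  proof (rule Lspace_holder_integrable)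
    show "(\<lambda>x. F\<xi> x $ k) \<in> Lspace \<Omega> (holder_conj (p / real (minor_size k)))"
      using F\<xi> by (simp add: S_dual_def)
    show "(\<lambda>x. Z h x ^ minor_size k) \<in> Lspace \<Omega> (ereal (p / real (minor_size k)))"
      using k by (intro Lspace_power Z_Lspace h Z_nonneg)
    show "1 \<le> p / real (minor_size k)" using k by simp
  qed
  then have "integrable M (\<lambda>x. fact (minor_size k) * (norm (F\<xi> x $ k) * norm (Z h x ^ minor_size k)))"
    by simp
  then show "integrable M (\<lambda>x. \<bar>F\<xi> x $ k\<bar> * (fact (minor_size k) * Z h x ^ minor_size k))"
    by (simp add: Z_nonneg mult.left_commute)
qed

text \<open>Used in two ways: with t = 1 for the minors themselves, and with t as the step size for
  their increments.\<close>

lemma inner_le_minor_majorant: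
  assumes "\<And>k. \<bar>v $ k\<bar> \<le> t * (fact (minor_size k) * r ^ minor_size k)" "0 \<le> r" "r \<le> Z h x" "0 \<le> t"
  shows "\<bar>F\<xi> x \<bullet> v\<bar> \<le> t * minor_majorant h x"
proof -
  have "\<bar>F\<xi> x $ k * v $ k\<bar> \<le> t * (\<bar>F\<xi> x $ k\<bar> * (fact (minor_size k) * Z h x ^ minor_size k))" for k
  proof -
    have "\<bar>v $ k\<bar> \<le> t * (fact (minor_size k) * Z h x ^ minor_size k)"
      using assms by (intro order_trans[OF assms(1)] mult_left_mono power_mono) auto
    then show ?thesis
      by (simp add: abs_mult mult.left_commute[of t] mult_left_mono)
  qed
  then show ?thesis
    unfolding inner_vec_def inner_real_def minor_majorant_def sum_distrib_left
    by (intro order_trans[OF sum_abs] sum_mono)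
qed

lemma inner_all_minors_integrable:
  assumes h: "h \<in> W1p \<Omega> p" and t: "0 \<le> t" "t \<le> 1"
  shows "integrable M (\<lambda>x. F\<xi> x \<bullet> all_minors (A x + t *\<^sub>R weak_grad \<Omega> h x))"
proof (rule Bochner_Integration.integrable_bound[OF minor_majorant_integrable[OF h]])
  show "(\<lambda>x. F\<xi> x \<bullet> all_minors (A x + t *\<^sub>R weak_grad \<Omega> h x)) \<in> borel_measurable M"
    using W1p_measurable[OF u] W1p_measurable[OF h]
    by (intro borel_measurable_inner F\<xi>_measurable all_minors_measurable) auto
  have "norm (A x + t *\<^sub>R weak_grad \<Omega> h x) \<le> Z h x" for x
  proof -
    have "norm (A x + t *\<^sub>R weak_grad \<Omega> h x) \<le> norm (A x) + norm (weak_grad \<Omega> h x)"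
      using t by (intro order_trans[OF norm_triangle_ineq] add_left_mono) (simp add: mult_left_le_one_le)
    also have "\<dots> \<le> Z h x" by (simp add: Z_def)
    finally show ?thesis .
  qed
  then have "\<bar>F\<xi> x \<bullet> all_minors (A x + t *\<^sub>R weak_grad \<Omega> h x)\<bar> \<le> 1 * minor_majorant h x" for x
    by (intro inner_le_minor_majorant[where r = "norm (A x + t *\<^sub>R weak_grad \<Omega> h x)"])
      (auto simp: all_minors_def intro: abs_minor_le)
  then show "AE x in M. norm (F\<xi> x \<bullet> all_minors (A x + t *\<^sub>R weak_grad \<Omega> h x)) \<le> norm (minor_majorant h x)"
    by (auto intro: order_trans[OF _ abs_ge_self])
qed

lemma inner_Fu_integrable:
  assumes h: "h \<in> W1p \<Omega> p"
  shows "integrable M (\<lambda>x. Fu x \<bullet> h x)"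
proof (rule Bochner_Integration.integrable_bound)
  show "integrable M (\<lambda>x. norm (Fu x) * norm (norm (h x)))"
    by (rule Lspace_holder_integrable[OF Fu Lspace_norm[OF W1pD(1)[OF open_\<Omega> h]] p(1)])
  show "(\<lambda>x. Fu x \<bullet> h x) \<in> borel_measurable M"
    using Fu W1p_measurable[OF h] by (auto simp: Lspace_def)
  show "AE x in M. norm (Fu x \<bullet> h x) \<le> norm (norm (Fu x) * norm (norm (h x)))"
    by (simp add: Cauchy_Schwarz_ineq2)
qed

lemma subgradient_diff_quotient:
  assumes w: "\<And>v. v \<in> W1p \<Omega> p \<Longrightarrow>
      w v = (LINT x|M. Fu x \<bullet> v x) + (LINT x|M. F\<xi> x \<bullet> all_minors (weak_grad \<Omega> v x))"
    and h: "h \<in> W1p \<Omega> p"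
  shows "(diff_quotient w u h \<longlongrightarrow> variation h) (at_right 0)"
proof -
  let ?T = "\<lambda>t x. all_minors (A x + t *\<^sub>R weak_grad \<Omega> h x)"
  \<comment> \<open>The first integral in w is linear in u, so its difference quotient is the same
    for all t; only the minors vary with t.\<close>
  let ?s = "\<lambda>t x. Fu x \<bullet> h x + (F\<xi> x \<bullet> ?T t x - F\<xi> x \<bullet> ?T 0 x) / t"
  have int_T: "integrable M (\<lambda>x. F\<xi> x \<bullet> ?T t x)" if "0 \<le> t" "t \<le> 1" for t
    using inner_all_minors_integrable[OF h that] .
  have int_s: "integrable M (?s t)" if "0 < t" "t < 1" for t
    using int_T[of t] int_T[of 0] inner_Fu_integrable[OF h] that by simp
  have bound: "AE x in M. \<bar>?s t x\<bar> \<le> \<bar>Fu x \<bullet> h x\<bar> + minor_majorant h x" if "0 < t" "t < 1" for t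
  proof (rule AE_I2)
    fix x
    have "norm (A x) + norm (weak_grad \<Omega> h x) \<le> Z h x"
      by (simp add: Z_def)
    then have "\<bar>F\<xi> x \<bullet> (?T t x - ?T 0 x)\<bar> \<le> t * minor_majorant h x"
      using that by (intro inner_le_minor_majorant[where r = "norm (A x) + norm (weak_grad \<Omega> h x)"])
        (auto simp: all_minors_def intro!: abs_minor_diff_le)
    then have "\<bar>(F\<xi> x \<bullet> ?T t x - F\<xi> x \<bullet> ?T 0 x) / t\<bar> \<le> minor_majorant h x"
      using that by (simp add: inner_diff_right field_simps)
    then show "\<bar>?s t x\<bar> \<le> \<bar>Fu x \<bullet> h x\<bar> + minor_majorant h x" by linarith
  qed
  have int_w: "integrable M (\<lambda>x. \<bar>Fu x \<bullet> h x\<bar> + minor_majorant h x)"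
    using inner_Fu_integrable[OF h] minor_majorant_integrable[OF h] by auto
  have lim: "((\<lambda>t. ?s t x) \<longlongrightarrow> variation_integrand h x) (at_right 0)" for x
  proof -
    have "(all_minors has_derivative frechet_derivative all_minors (at (A x))) (at (A x))"
      using all_minors_differentiable by (simp add: frechet_derivative_works)
    then have "((\<lambda>B. F\<xi> x \<bullet> all_minors B) has_derivative (\<lambda>B. F\<xi> x \<bullet> frechet_derivative all_minors (at (A x)) B)) (at (A x))"
      by (rule has_derivative_inner_right)
    from tendsto_add[OF tendsto_const directional_derivative_at_right[OF this]]
    show ?thesis by (simp add: variation_integrand_def)
  qed
  note dct = dominated_convergence_at_right(2)[where s = ?s, OF borel_measurable_integrable[OF int_s] bound int_w AE_I2[OF lim]]
  have "\<forall>\<^sub>F t in at_right 0. (LINT x|M. ?s t x) = diff_quotient w u h t"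
    using eventually_at_right_real[of 0 1, OF zero_less_one]
  proof eventually_elim
    case (elim t)
    then have t: "0 < t" "t < 1" by auto
    note step = W1p_add_scaleR[OF open_\<Omega> _ u h, of t]
    have "(LINT x|M. F\<xi> x \<bullet> all_minors (weak_grad \<Omega> (\<lambda>x. u x + t *\<^sub>R h x) x)) = (LINT x|M. F\<xi> x \<bullet> ?T t x)"
    proof (rule integral_cong_AE)
      show "(\<lambda>x. F\<xi> x \<bullet> all_minors (weak_grad \<Omega> (\<lambda>x. u x + t *\<^sub>R h x) x)) \<in> borel_measurable M"
        using step(1) p by (intro borel_measurable_inner F\<xi>_measurable all_minors_measurable W1p_measurable) auto
      show "(\<lambda>x. F\<xi> x \<bullet> ?T t x) \<in> borel_measurable M"
        using int_T[of t] t by auto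
      show "AE x in M. F\<xi> x \<bullet> all_minors (weak_grad \<Omega> (\<lambda>x. u x + t *\<^sub>R h x) x) = F\<xi> x \<bullet> ?T t x"
        using step(2) p by (auto elim!: eventually_mono)
    qed
    moreover have "(LINT x|M. Fu x \<bullet> (u x + t *\<^sub>R h x)) = (LINT x|M. Fu x \<bullet> u x) + t * (LINT x|M. Fu x \<bullet> h x)"
      using inner_Fu_integrable[OF u] inner_Fu_integrable[OF h] by (simp add: inner_add_right)
    ultimately have "w (\<lambda>x. u x + t *\<^sub>R h x) - w u =
        t * (LINT x|M. Fu x \<bullet> h x) + ((LINT x|M. F\<xi> x \<bullet> ?T t x) - (LINT x|M. F\<xi> x \<bullet> ?T 0 x))"
      using step(1) p u by (simp add: w)
    moreover have "(LINT x|M. ?s t x) =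
        (LINT x|M. Fu x \<bullet> h x) + ((LINT x|M. F\<xi> x \<bullet> ?T t x) - (LINT x|M. F\<xi> x \<bullet> ?T 0 x)) / t"
      using int_T[of t] int_T[of 0] inner_Fu_integrable[OF h] t by simp
    ultimately show ?case
      using t by (simp add: diff_quotient_def field_simps)
  qed
  then show ?thesis
    using dct unfolding variation_def by (rule Lim_transform_eventually[rotated])
qed

section \<open>Linearity of the variation\<close>

lemma linear_frechet_all_minors: "linear (frechet_derivative all_minors (at B))"
  using all_minors_differentiable by (rule linear_frechet_derivative)

lemma variation_add:
  assumes "h \<in> W1p \<Omega> p" "k \<in> W1p \<Omega> p"
  shows "variation (\<lambda>x. h x + k x) = variation h + variation k"
proof -
  have hk: "(\<lambda>x. h x + k x) \<in> W1p \<Omega> p"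
    "AE x in M. weak_grad \<Omega> (\<lambda>x. h x + k x) x = weak_grad \<Omega> h x + weak_grad \<Omega> k x"
    using W1p_add[OF open_\<Omega> _ assms] p by auto
  have "variation (\<lambda>x. h x + k x) = (LINT x|M. variation_integrand h x + variation_integrand k x)"
    unfolding variation_def
    using hk(2) by (intro integral_cong_AE borel_measurable_integrable Bochner_Integration.integrable_add
        variation_integrable hk assms)
      (auto elim!: eventually_mono simp: variation_integrand_def inner_add_right linear_add[OF linear_frechet_all_minors])
  then show ?thesis
    using variation_integrable assms by (simp add: variation_def)
qed

lemma variation_scaleR:
  assumes "h \<in> W1p \<Omega> p"
  shows "variation (\<lambda>x. r *\<^sub>R h x) = r *\<^sub>R variation h"
proof -
  have rh: "(\<lambda>x. r *\<^sub>R h x) \<in> W1p \<Omega> p"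
    "AE x in M. weak_grad \<Omega> (\<lambda>x. r *\<^sub>R h x) x = r *\<^sub>R weak_grad \<Omega> h x"
    using W1p_scaleR[OF open_\<Omega> _ assms] p by auto
  have "variation (\<lambda>x. r *\<^sub>R h x) = (LINT x|M. r *\<^sub>R variation_integrand h x)"
    unfolding variation_def
    using rh(2) by (intro integral_cong_AE borel_measurable_integrable integrable_scaleR_right
        variation_integrable rh assms)
      (auto elim!: eventually_mono simp: variation_integrand_def linear_scale[OF linear_frechet_all_minors] algebra_simps)
  then show ?thesis by (simp add: variation_def)
qed

end

section \<open>The source condition\<close>

lemma gateaux_deriv_eq:
  assumes "\<And>h. h \<in> W1p \<Omega> p \<Longrightarrow> (diff_quotient G u h \<longlongrightarrow> L h) (at_right 0)"
  shows "gateaux_deriv \<Omega> p G u = restrict L (W1p \<Omega> p)"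
  unfolding gateaux_deriv_def
  by (rule restrict_ext) (rule tendsto_Lim[OF trivial_limit_at_right_real assms])

text \<open>The increment is t times a convergent quotient. The resulting continuity along rays, for
  K and R, keeps u_dag + t h in the set where the source inequality is assumed.\<close>

lemma diff_quotient_tendsto_imp_tendsto:
  fixes G :: "('a \<Rightarrow> 'b::real_vector) \<Rightarrow> 'v::real_normed_vector"
  assumes "(diff_quotient G u h \<longlongrightarrow> l) (at_right 0)"
  shows "((\<lambda>t. G (\<lambda>x. u x + t *\<^sub>R h x)) \<longlongrightarrow> G u) (at_right 0)"
proof -
  have "((\<lambda>t. G u + t *\<^sub>R diff_quotient G u h t) \<longlongrightarrow> G u + 0 *\<^sub>R l) (at_right 0)"
    by (intro tendsto_intros assms)
  moreover have "\<forall>\<^sub>F t in at_right 0. G u + t *\<^sub>R diff_quotient G u h t = G (\<lambda>x. u x + t *\<^sub>R h x)"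
    by (auto simp: eventually_at_filter diff_quotient_def)
  ultimately show ?thesis
    by (auto dest: Lim_transform_eventually)
qed

theorem theorem1:
  fixes \<Omega> :: "'n::{finite,linorder} rvec set"
    and p q :: real
    and K :: "('n rvec \<Rightarrow> 'N::{finite,linorder} rvec) \<Rightarrow> 'v::banach"
    and v_dag :: 'v
    and F :: "'n rvec \<Rightarrow> 'N rvec \<Rightarrow> ('N, 'n) minor_index rvec \<Rightarrow> ennreal"
    and f :: "'n rvec \<Rightarrow> 'N rvec \<Rightarrow> ('N, 'n) rmat \<Rightarrow> ennreal"
    and R :: "('n rvec \<Rightarrow> 'N rvec) \<Rightarrow> ennreal"
    and U :: "('n rvec \<Rightarrow> 'N rvec) set"
    and u_dag :: "'n rvec \<Rightarrow> 'N rvec"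
    and w :: "('n rvec \<Rightarrow> 'N rvec) \<Rightarrow> real"
    and Fu :: "'n rvec \<Rightarrow> 'N rvec"
    and F\<xi> :: "'n rvec \<Rightarrow> ('N, 'n) minor_index rvec"
    and \<beta>1 \<beta>2 \<alpha> \<rho> b c :: real
    and a :: "'n rvec \<Rightarrow> real"
  assumes "open \<Omega>"
    and "1 \<le> p" and "real (min CARD('N) CARD('n)) \<le> p"
    and "1 \<le> q"
    and U_def: "U = W1p \<Omega> p"
    and "respects_ae \<Omega> p K"
    and "caratheodory \<Omega> F"
    and "AE x in lebesgue_on \<Omega>. convex_ennreal (\<lambda>(u, \<xi>). F x u \<xi>)"
    and "AE x in lebesgue_on \<Omega>. differentiable_on_domain (\<lambda>(u, \<xi>). F x u \<xi>)"
    and f_def: "f = polyconvex_integrand F"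
    and R_def: "R = polyconvex_functional \<Omega> F"
    and "u_dag \<in> U" and "K u_dag = v_dag" and "\<forall>u\<in>U. K u = v_dag \<longrightarrow> R u_dag \<le> R u"
    and "u_dag \<in> W1p_interior \<Omega> p {u\<in>U. R u < \<infinity>}"
    and Fu_def: "Fu = (\<lambda>x. fst (grad_joint F x (u_dag x) (all_minors (weak_grad \<Omega> u_dag x))))"
    and F\<xi>_def: "F\<xi> = (\<lambda>x. snd (grad_joint F x (u_dag x) (all_minors (weak_grad \<Omega> u_dag x))))"
    and "Fu \<in> Lspace \<Omega> (holder_conj p)" and "F\<xi> \<in> S_dual \<Omega> p"
    and w_def: "\<forall>u\<in>U. w u = (LINT x|lebesgue_on \<Omega>. Fu x \<bullet> u x) +
                  (LINT x|lebesgue_on \<Omega>. F\<xi> x \<bullet> all_minors (weak_grad \<Omega> u x))"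
    and "0 \<le> \<beta>1" and "\<beta>1 < 1" and "0 < \<beta>2" and "0 < \<alpha>"
    and "ennreal \<alpha> * R u_dag < ennreal \<rho>"
    and "\<forall>u\<in>U. ennreal (norm (K u - v_dag) powr q) + ennreal \<alpha> * R u \<le> ennreal \<rho> \<longrightarrow>
           ereal (w u_dag - w u) \<le>
             ereal \<beta>1 * bregman_distance R w u u_dag + ereal (\<beta>2 * norm (K u - v_dag))"
    and "a \<in> Lspace \<Omega> (holder_conj p)" and "0 \<le> b" and "0 \<le> c"
    and "AE x in lebesgue_on \<Omega>. \<forall>u A. f x u A < \<infinity> \<longrightarrow>
           norm (grad_joint f x u A) \<le> a x + b * rpow (norm u) (p - 1) + c * rpow (norm A) (p - 1)"
    and "gateaux_differentiable \<Omega> p K u_dag"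
  shows "gateaux_differentiable \<Omega> p (\<lambda>u. enn2real (R u)) u_dag \<and>
         gateaux_differentiable \<Omega> p w u_dag \<and>
         gateaux_deriv \<Omega> p (\<lambda>u. enn2real (R u)) u_dag = gateaux_deriv \<Omega> p w u_dag \<and>
         gateaux_deriv \<Omega> p w u_dag \<in> range (dual_adjoint \<Omega> p (gateaux_deriv \<Omega> p K u_dag))"
proof -
  \<comment> \<open>As \<alpha> is positive, an infinite value would make the left side of the
    assumption infinite.\<close>
  have "R u_dag < \<infinity>"
    using \<open>ennreal \<alpha> * R u_dag < ennreal \<rho>\<close> \<open>0 < \<alpha>\<close>
    by (cases "R u_dag") (auto simp: ennreal_mult_top)
  then interpret polyconvex_growth \<Omega> p b c F u_dag a Fu F\<xi>
    using assms by unfold_locales simp_all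
  have u: "u_dag \<in> W1p \<Omega> p" using assms by simp
  obtain r0 where r0: "R u_dag = ennreal r0" "0 \<le> r0"
    using \<open>R u_dag < \<infinity>\<close> by (cases "R u_dag") auto
  obtain L C where L_add: "\<And>h k. h \<in> W1p \<Omega> p \<Longrightarrow> k \<in> W1p \<Omega> p \<Longrightarrow> L (\<lambda>x. h x + k x) = L h + L k"
    and L_scale: "\<And>r h. h \<in> W1p \<Omega> p \<Longrightarrow> L (\<lambda>x. r *\<^sub>R h x) = r *\<^sub>R L h"
    and L_bound: "\<And>h. h \<in> W1p \<Omega> p \<Longrightarrow> norm (L h) \<le> C * W1p_norm \<Omega> p h"
    and K_lim: "\<And>h. h \<in> W1p \<Omega> p \<Longrightarrow> (diff_quotient K u_dag h \<longlongrightarrow> L h) (at_right 0)"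
    using \<open>gateaux_differentiable \<Omega> p K u_dag\<close>
    unfolding gateaux_differentiable_def W1p_bounded_linear_def by blast
  have R_lim: "(diff_quotient (\<lambda>v. enn2real (R v)) u_dag h \<longlongrightarrow> variation h) (at_right 0)"
    if "h \<in> W1p \<Omega> p" for h
    unfolding R_def using that by (rule functional_diff_quotient)
  have w_lim: "(diff_quotient w u_dag h \<longlongrightarrow> variation h) (at_right 0)" if "h \<in> W1p \<Omega> p" for h
    using that w_def by (intro subgradient_diff_quotient) (auto simp: U_def)
  have R_deriv: "gateaux_deriv \<Omega> p (\<lambda>v. enn2real (R v)) u_dag = restrict variation (W1p \<Omega> p)"
    and w_deriv: "gateaux_deriv \<Omega> p w u_dag = restrict variation (W1p \<Omega> p)"
    and K_deriv: "gateaux_deriv \<Omega> p K u_dag = restrict L (W1p \<Omega> p)"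
    by (rule gateaux_deriv_eq, rule R_lim w_lim K_lim, assumption)+
  have one_sided: "- variation h \<le> \<beta>2 * norm (L h)" if h: "h \<in> W1p \<Omega> p" for h
  proof -
    let ?u = "\<lambda>t x. u_dag x + t *\<^sub>R h x"
    have Ku: "((\<lambda>t. norm (K (?u t) - v_dag)) \<longlongrightarrow> norm (K u_dag - v_dag)) (at_right 0)"
      by (intro tendsto_intros diff_quotient_tendsto_imp_tendsto[OF K_lim[OF h]])
    \<comment> \<open>The base tends to 0, where continuity of the power requires a positive
      exponent.\<close>
    have "((\<lambda>t. norm (K (?u t) - v_dag) powr q) \<longlongrightarrow> norm (K u_dag - v_dag) powr q) (at_right 0)"
      using \<open>1 \<le> q\<close> by (intro tendsto_powr'[OF Ku tendsto_const]) simp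
    then have "((\<lambda>t. norm (K (?u t) - v_dag) powr q + \<alpha> * enn2real (R (?u t))) \<longlongrightarrow>
        norm (K u_dag - v_dag) powr q + \<alpha> * enn2real (R u_dag)) (at_right 0)"
      by (intro tendsto_add tendsto_mult_left diff_quotient_tendsto_imp_tendsto[OF R_lim[OF h]])
    moreover have "norm (K u_dag - v_dag) powr q + \<alpha> * enn2real (R u_dag) < \<rho>"
    proof -
      have "ennreal (\<alpha> * r0) < ennreal \<rho>"
        using \<open>ennreal \<alpha> * R u_dag < ennreal \<rho>\<close> \<open>0 < \<alpha>\<close> r0 by (simp only: ennreal_mult less_imp_le)
      then have "\<alpha> * r0 < \<rho>"
        using \<open>0 < \<alpha>\<close> r0 by (subst (asm) ennreal_less_iff) auto
      then show ?thesis
        using \<open>K u_dag = v_dag\<close> r0 by simp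
    qed
    ultimately have "\<forall>\<^sub>F t in at_right 0. norm (K (?u t) - v_dag) powr q + \<alpha> * enn2real (R (?u t)) < \<rho>"
      by (rule order_tendstoD)
    \<comment> \<open>The source inequality at u_dag + t h, divided by t. Both values of R are
      finite there, so the extended Bregman distance becomes ordinary real arithmetic.\<close>
    then have ineq: "\<forall>\<^sub>F t in at_right 0. - diff_quotient w u_dag h t \<le>
        \<beta>1 * (diff_quotient (\<lambda>v. enn2real (R v)) u_dag h t - diff_quotient w u_dag h t) +
        \<beta>2 * norm (diff_quotient K u_dag h t)"
      using eventually_at_right_real[of 0 1, OF zero_less_one]
    proof eventually_elim
      case (elim t)
      then have t: "0 < t" "t < 1" by auto
      have ut: "?u t \<in> U"
        using W1p_add_scaleR(1)[OF \<open>open \<Omega>\<close> _ u h] \<open>1 \<le> p\<close> by (simp add: U_def)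
      have "R (?u t) \<noteq> \<infinity>"
        using functional_finite[OF h, of t] t by (simp add: R_def)
      then obtain rt where rt: "R (?u t) = ennreal rt" "0 \<le> rt"
        by (cases "R (?u t)") auto
      note r = r0 rt
      have "ennreal (norm (K (?u t) - v_dag) powr q) + ennreal \<alpha> * R (?u t) \<le> ennreal \<rho>"
        using elim(1) r \<open>0 < \<alpha>\<close> by (simp add: ennreal_leI flip: ennreal_mult ennreal_plus)
      then have "ereal (w u_dag - w (?u t)) \<le>
          ereal \<beta>1 * bregman_distance R w (?u t) u_dag + ereal (\<beta>2 * norm (K (?u t) - v_dag))"
        using assms(26) ut by blast
      then have "w u_dag - w (?u t) \<le>
          \<beta>1 * (rt - r0 - w (?u t) + w u_dag) + \<beta>2 * norm (K (?u t) - v_dag)"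
        using r by (simp add: bregman_distance_def enn2ereal_ennreal)
      then have "- (w (?u t) - w u_dag) \<le>
          \<beta>1 * ((rt - r0) - (w (?u t) - w u_dag)) + \<beta>2 * norm (K (?u t) - v_dag)"
        by (simp only: minus_diff_eq diff_diff_eq2 diff_add_eq)
      then have le: "s * - (w (?u t) - w u_dag) \<le>
          s * (\<beta>1 * ((rt - r0) - (w (?u t) - w u_dag)) + \<beta>2 * norm (K (?u t) - v_dag))" if "0 \<le> s" for s
        using that by (rule mult_left_mono)
      have "diff_quotient w u_dag h t = 1 / t * (w (?u t) - w u_dag)"
        "diff_quotient (\<lambda>v. enn2real (R v)) u_dag h t = 1 / t * (rt - r0)"
        "norm (diff_quotient K u_dag h t) = 1 / t * norm (K (?u t) - v_dag)"
        using t r \<open>K u_dag = v_dag\<close> by (simp_all add: diff_quotient_def)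
      then show ?case
        using le[of "1 / t"] t by (simp only: distrib_left right_diff_distrib mult.left_commute[of "1 / t"])
          (simp add: diff_divide_distrib)
    qed
    have "((\<lambda>t. - diff_quotient w u_dag h t) \<longlongrightarrow> - variation h) (at_right 0)"
      by (intro tendsto_minus w_lim h)
    moreover have "((\<lambda>t. \<beta>1 * (diff_quotient (\<lambda>v. enn2real (R v)) u_dag h t - diff_quotient w u_dag h t) +
        \<beta>2 * norm (diff_quotient K u_dag h t)) \<longlongrightarrow>
        \<beta>1 * (variation h - variation h) + \<beta>2 * norm (L h)) (at_right 0)"
      by (intro tendsto_add tendsto_mult_left tendsto_diff tendsto_norm R_lim w_lim K_lim h)
    ultimately have "- variation h \<le> \<beta>1 * (variation h - variation h) + \<beta>2 * norm (L h)"
      using tendsto_le[OF trivial_limit_at_right_real _ _ ineq] by blast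
    then show ?thesis by simp
  qed
  \<comment> \<open>The one-sided estimate for h and for (-1) h, combined by linearity of both
    sides.\<close>
  have bound: "\<bar>variation h\<bar> \<le> \<beta>2 * norm (L h)" if h: "h \<in> W1p \<Omega> p" for h
    using one_sided[OF h] one_sided[OF W1p_scaleR(1)[OF \<open>open \<Omega>\<close> _ h, of "- 1"]]
      variation_scaleR[OF h, of "- 1"] L_scale[OF h, of "- 1"] \<open>1 \<le> p\<close>
    by simp
  have norm_le: "norm (variation h) \<le> (\<beta>2 * C) * W1p_norm \<Omega> p h" if "h \<in> W1p \<Omega> p" for h
  proof -
    have "\<beta>2 * norm (L h) \<le> \<beta>2 * (C * W1p_norm \<Omega> p h)"
      using L_bound[OF that] \<open>0 < \<beta>2\<close> by (intro mult_left_mono) auto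
    then show ?thesis
      unfolding mult.assoc real_norm_def using bound[OF that] by linarith
  qed
  have "W1p_bounded_linear \<Omega> p variation"
    unfolding W1p_bounded_linear_def
  proof (intro conjI ballI allI)
    show "\<exists>C. \<forall>h\<in>W1p \<Omega> p. norm (variation h) \<le> C * W1p_norm \<Omega> p h"
      using norm_le by blast
  qed (erule (1) variation_add, erule variation_scaleR)
  then have "gateaux_differentiable \<Omega> p (\<lambda>u. enn2real (R u)) u_dag" "gateaux_differentiable \<Omega> p w u_dag"
    unfolding gateaux_differentiable_def using R_lim w_lim by blast+
  moreover have "gateaux_deriv \<Omega> p w u_dag \<in> range (dual_adjoint \<Omega> p (gateaux_deriv \<Omega> p K u_dag))"
  proof -
    \<comment> \<open>The graph of the relation that sends K'(u_dag) h to w'(h). The estimate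
      \<open>bound\<close> makes it single-valued, as w'(h) = 0 whenever K'(u_dag) h = 0.\<close>
    let ?S = "(\<lambda>h. (L h, variation h)) ` W1p \<Omega> p"
    have "subspace ?S"
      unfolding subspace_def
    proof (intro conjI ballI allI)
      show "0 \<in> ?S"
      proof (rule image_eqI)
        \<comment> \<open>The zero function is represented as 0 times u_dag, so that homogeneity and
          closure under scaling apply.\<close>
        show "0 = (L (\<lambda>x. 0 *\<^sub>R u_dag x), variation (\<lambda>x. 0 *\<^sub>R u_dag x))"
          unfolding L_scale[OF u] variation_scaleR[OF u] by (simp add: zero_prod_def)
        show "(\<lambda>x. 0 *\<^sub>R u_dag x) \<in> W1p \<Omega> p"
          by (rule W1p_scaleR(1)[OF \<open>open \<Omega>\<close> _ u]) (use \<open>1 \<le> p\<close> in simp)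
      qed
    next
      fix s s' assume "s \<in> ?S" "s' \<in> ?S"
      then obtain h k where "h \<in> W1p \<Omega> p" "k \<in> W1p \<Omega> p" "s = (L h, variation h)" "s' = (L k, variation k)"
        by blast
      then show "s + s' \<in> ?S"
        using W1p_add(1)[OF \<open>open \<Omega>\<close>, of p h k] \<open>1 \<le> p\<close>
        by (intro image_eqI[of _ _ "\<lambda>x. h x + k x"]) (simp_all add: L_add variation_add)
    next
      fix r s assume "s \<in> ?S"
      then obtain h where "h \<in> W1p \<Omega> p" "s = (L h, variation h)" by blast
      then show "r *\<^sub>R s \<in> ?S"
        using W1p_scaleR(1)[OF \<open>open \<Omega>\<close>, of p h r] \<open>1 \<le> p\<close>
        by (intro image_eqI[of _ _ "\<lambda>x. r *\<^sub>R h x"]) (simp_all add: L_scale variation_scaleR)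
    qed
    moreover have "\<bar>r\<bar> \<le> \<beta>2 * norm v" if "(v, r) \<in> ?S" for v r
      using that bound by auto
    ultimately obtain l :: "'v \<Rightarrow>\<^sub>L real" where "\<forall>(v, r)\<in>?S. blinfun_apply l v = r"
      using hahn_banach_graph[of ?S \<beta>2] \<open>0 < \<beta>2\<close> by auto
    then have "variation h = blinfun_apply l (L h)" if "h \<in> W1p \<Omega> p" for h
      using that by auto
    \<comment> \<open>Off \<open>W1p\<close> both sides are \<open>undefined\<close>, so agreement
      on \<open>W1p\<close> is equality of functions.\<close>
    then have "gateaux_deriv \<Omega> p w u_dag = dual_adjoint \<Omega> p (gateaux_deriv \<Omega> p K u_dag) l"
      by (simp add: w_deriv K_deriv dual_adjoint_def restrict_def fun_eq_iff)
    then show ?thesis by blast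
  qed
  ultimately show ?thesis
    using R_deriv w_deriv by simp
qed

end
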